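(* The Set Family Edge Cover problem restricted to $\gamma$-pliable set families admits approximation ratio $10$. That is, there is an algorithm which, given a finite graph $G=(V,E)$ with edge costs $c_e \ge 0$ ($e\in E$) and a $\gamma$-pliable set family $\mathcal{F}$ on $V$ with $\emptyset, V\notin\mathcal{F}$ such that $E$ covers every member of $\mathcal{F}$ (where $\mathcal{F}$ is accessed only through an oracle that, for any $I\subseteq E$, returns the inclusion-minimal members of the residual family $\mathcal{F}^I$), runs in polynomial time (counting oracle calls as unit cost) and outputs an edge set $J\subseteq E$ with $d_J(S)\ge 1$ for all $S\in\mathcal{F}$ and with cost $\sum_{e\in J}c_e$ at most $10$ times the minimum cost of an edge set $J^*\subseteq E$ satisfying $d_{J^*}(S)\ge 1$ for all $S\in\mathcal{F}$.
   Context: Let $G=(V,E)$ be a finite graph. For $J\subseteq E$ and $S\subseteq V$, $\delta_J(S)$ is the set of edges in $J$ with exactly one end in $S$, and $d_J(S)=|\delta_J(S)|$. An edge set $J$ (or an edge) covers $S$ if it contains (is) an edge with exactly one end in $S$; $J$ covers a set family if it covers each of its members. For a set family $\mathcal{F}$ on $V$ and an edge set $I\subseteq E$, the residual family is $\mathcal{F}^I=\{S\in\mathcal{F}: d_I(S)=0\}$. Two sets $A,B\subseteq V$ cross if each of $A\cap B$, $V\setminus(A\cup B)$, $A\setminus B$, $B\setminus A$ is non-empty. A set family $\mathcal{F}$ is pliable if for any $A,B\in\mathcal{F}$ at least two of the four sets $A\cap B$, $A\cup B$, $A\setminus B$, $B\setminus A$ belong to $\mathcal{F}$ (the four expressions are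 counted separately, even if some coincide as sets). $\mathcal{F}$ is $\gamma$-pliable if it is pliable and satisfies Property $(\gamma)$: for any edge set $I$ and sets $S_1\subset S_2$ (proper inclusion) in $\mathcal{F}^I$, if an inclusion-minimal set $C$ of $\mathcal{F}^I$ crosses each of $S_1,S_2$, then $S_2\setminus(S_1\cup C)$ is either empty or belongs to $\mathcal{F}^I$. Set Family Edge Cover: given a graph $G=(V,E)$ with edge costs and a set family $\mathcal{F}$ on $V$, find a minimum-cost $J\subseteq E$ with $d_J(S)\ge 1$ for all $S\in\mathcal{F}$. The family $\mathcal{F}$ need not be given explicitly, but it is assumed that for any edge set $I$ the inclusion-minimal members of $\mathcal{F}^I$ can be computed in time polynomial in $|V|$, and that $\emptyset,V\notin\mathcal{F}$. *)

theory Defs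
  imports Complex_Main "HOL-Computational_Algebra.Polynomial"
begin

section \<open>Graphs, set families and edge covers\<close>

text \<open>
  A graph is given by a vertex set, a set of edge names and a map from edge names to
  pairs of ends. The order within a pair is irrelevant, and parallel edges are allowed.
\<close>

definition is_graph :: "'v set \<Rightarrow> 'e set \<Rightarrow> ('e \<Rightarrow> 'v \<times> 'v) \<Rightarrow> bool" where
  "is_graph V E ends \<longleftrightarrow> finite V \<and> finite E \<and>
     (\<forall>e\<in>E. fst (ends e) \<in> V \<and> snd (ends e) \<in> V \<and> fst (ends e) \<noteq> snd (ends e))"

definition cut :: "('e \<Rightarrow> 'v \<times> 'v) \<Rightarrow> 'e set \<Rightarrow> 'v set \<Rightarrow> 'e set" where
  "cut ends J S = {e\<in>J. (fst (ends e) \<in> S) \<noteq> (snd (ends e) \<in> S)}"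

definition cut_deg :: "('e \<Rightarrow> 'v \<times> 'v) \<Rightarrow> 'e set \<Rightarrow> 'v set \<Rightarrow> nat" where
  "cut_deg ends J S = card (cut ends J S)"

definition covers :: "('e \<Rightarrow> 'v \<times> 'v) \<Rightarrow> 'e set \<Rightarrow> 'v set set \<Rightarrow> bool" where
  "covers ends J F \<longleftrightarrow> (\<forall>S\<in>F. cut_deg ends J S \<ge> 1)"

definition residual :: "('e \<Rightarrow> 'v \<times> 'v) \<Rightarrow> 'v set set \<Rightarrow> 'e set \<Rightarrow> 'v set set" where
  "residual ends F I = {S\<in>F. cut_deg ends I S = 0}"

definition minimal_members :: "'v set set \<Rightarrow> 'v set set" where
  "minimal_members F = {C\<in>F. \<forall>S\<in>F. \<not> S \<subset> C}"

definition crossing :: "'v set \<Rightarrow> 'v set \<Rightarrow> 'v set \<Rightarrow> bool" where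
  "crossing V A B \<longleftrightarrow> A \<inter> B \<noteq> {} \<and> V - (A \<union> B) \<noteq> {} \<and> A - B \<noteq> {} \<and> B - A \<noteq> {}"

text \<open>The four sets are listed, not collected in a set, so coinciding ones count separately.\<close>

definition pliable :: "'v set set \<Rightarrow> bool" where
  "pliable F \<longleftrightarrow>
     (\<forall>A\<in>F. \<forall>B\<in>F. length (filter (\<lambda>X. X \<in> F) [A \<inter> B, A \<union> B, A - B, B - A]) \<ge> 2)"

definition property_gamma ::
    "'v set \<Rightarrow> 'e set \<Rightarrow> ('e \<Rightarrow> 'v \<times> 'v) \<Rightarrow> 'v set set \<Rightarrow> bool" where
  "property_gamma V E ends F \<longleftrightarrow>
     (\<forall>I\<subseteq>E. \<forall>S1\<in>residual ends F I. \<forall>S2\<in>residual ends F I.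
        \<forall>C\<in>minimal_members (residual ends F I).
          S1 \<subset> S2 \<and> crossing V C S1 \<and> crossing V C S2 \<longrightarrow>
          S2 - (S1 \<union> C) = {} \<or> S2 - (S1 \<union> C) \<in> residual ends F I)"

definition gamma_pliable ::
    "'v set \<Rightarrow> 'e set \<Rightarrow> ('e \<Rightarrow> 'v \<times> 'v) \<Rightarrow> 'v set set \<Rightarrow> bool" where
  "gamma_pliable V E ends F \<longleftrightarrow> pliable F \<and> property_gamma V E ends F"

definition cover_instance ::
    "'v set \<Rightarrow> 'e set \<Rightarrow> ('e \<Rightarrow> 'v \<times> 'v) \<Rightarrow> ('e \<Rightarrow> real) \<Rightarrow> 'v set set \<Rightarrow> bool" where
  "cover_instance V E ends c F \<longleftrightarrow>
     is_graph V E ends \<and> (\<forall>e\<in>E. 0 \<le> c e) \<and>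
     F \<subseteq> Pow V \<and> {} \<notin> F \<and> V \<notin> F \<and> covers ends E F"

definition min_cover_cost ::
    "'e set \<Rightarrow> ('e \<Rightarrow> 'v \<times> 'v) \<Rightarrow> ('e \<Rightarrow> real) \<Rightarrow> 'v set set \<Rightarrow> real" where
  "min_cover_cost E ends c F = Min (sum c ` {J. J \<subseteq> E \<and> covers ends J F})"


section \<open>Machine model\<close>

text \<open>
  A structured random access machine. A program has finitely many named two-dimensional
  arrays of natural numbers and one-dimensional arrays of reals; scalars are the entries
  at index 0. The only arithmetic is addition and subtraction (truncated on \<^typ>\<open>nat\<close>).
  Without multiplication, the bit length of the stored numbers grows by at most a constant
  per step, so on rational data unit-cost time on this machine is polynomially equivalent
  to Turing machine time. Reals can be compared but not converted to natural numbers.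
\<close>

type_synonym name = string

record state =
  nats :: "name \<Rightarrow> nat \<Rightarrow> nat \<Rightarrow> nat"
  reals :: "name \<Rightarrow> nat \<Rightarrow> real"

datatype nexp =
    Num nat
  | Elem name nexp nexp
  | Add nexp nexp
  | Sub nexp nexp

datatype rexp =
    RNum nat
  | RElem name nexp
  | RAdd rexp rexp
  | RSub rexp rexp

datatype bexp =
    Less nexp nexp
  | RLess rexp rexp
  | BNot bexp
  | BAnd bexp bexp

datatype com =
    Skip
  | Assign name nexp nexp nexp
  | RAssign name nexp rexp
  | Query name name name
  | Seq com com
  | Cond bexp com com
  | While bexp com

primrec nval :: "nexp \<Rightarrow> state \<Rightarrow> nat" where
  "nval (Num k) s = k"
| "nval (Elem x i j) s = nats s x (nval i s) (nval j s)"
| "nval (Add a b) s = nval a s + nval b s"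
| "nval (Sub a b) s = nval a s - nval b s"

primrec rval :: "rexp \<Rightarrow> state \<Rightarrow> real" where
  "rval (RNum k) s = real k"
| "rval (RElem x i) s = reals s x (nval i s)"
| "rval (RAdd a b) s = rval a s + rval b s"
| "rval (RSub a b) s = rval a s - rval b s"

primrec bval :: "bexp \<Rightarrow> state \<Rightarrow> bool" where
  "bval (Less a b) s \<longleftrightarrow> nval a s < nval b s"
| "bval (RLess a b) s \<longleftrightarrow> rval a s < rval b s"
| "bval (BNot b) s \<longleftrightarrow> \<not> bval b s"
| "bval (BAnd a b) s \<longleftrightarrow> bval a s \<and> bval b s"

definition set_nat :: "name \<Rightarrow> nat \<Rightarrow> nat \<Rightarrow> nat \<Rightarrow> state \<Rightarrow> state" where
  "set_nat x i j k s = s\<lparr>nats := (nats s)(x := (nats s x)(i := (nats s x i)(j := k)))\<rparr>"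

definition set_real :: "name \<Rightarrow> nat \<Rightarrow> real \<Rightarrow> state \<Rightarrow> state" where
  "set_real x i r s = s\<lparr>reals := (reals s)(x := (reals s x)(i := r))\<rparr>"

text \<open>A set of natural numbers is stored as a 0/1 vector in row 0 of an array.\<close>

definition read_set :: "state \<Rightarrow> name \<Rightarrow> nat set" where
  "read_set s x = {e. nats s x 0 e \<noteq> 0}"

text \<open>The answer to a query is a list of sets: its length goes to the scalar \<open>k\<close>, and the
  characteristic vector of its \<open>i\<close>-th set to row \<open>i\<close> of the array \<open>x\<close>.\<close>

definition store_answer :: "name \<Rightarrow> name \<Rightarrow> nat set list \<Rightarrow> state \<Rightarrow> state" where
  "store_answer k x Ss s =
     set_nat k 0 0 (length Ss)
       (s\<lparr>nats := (nats s)(x := (\<lambda>i v. if i < length Ss \<and> v \<in> Ss ! i then 1 else 0))\<rparr>)"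

text \<open>
  \<open>exec Q c s t s'\<close>: with queries answered by \<open>Q\<close>, the program \<open>c\<close> started in \<open>s\<close> halts
  in \<open>s'\<close> after \<open>t\<close> steps. Assignments, tests and queries take one step each; the
  expressions in a fixed program have bounded size.
\<close>

inductive exec ::
    "(nat set \<Rightarrow> nat set list) \<Rightarrow> com \<Rightarrow> state \<Rightarrow> nat \<Rightarrow> state \<Rightarrow> bool"
  for Q :: "nat set \<Rightarrow> nat set list" where
  Skip: "exec Q Skip s 1 s"
| Assign: "exec Q (Assign x i j a) s 1 (set_nat x (nval i s) (nval j s) (nval a s) s)"
| RAssign: "exec Q (RAssign x i a) s 1 (set_real x (nval i s) (rval a s) s)"
| Query: "exec Q (Query q k x) s 1 (store_answer k x (Q (read_set s q)) s)"
| Seq: "exec Q c1 s t1 s1 \<Longrightarrow> exec Q c2 s1 t2 s2 \<Longrightarrow> exec Q (Seq c1 c2) s (t1 + t2) s2"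
| CondTrue: "bval b s \<Longrightarrow> exec Q c1 s t s' \<Longrightarrow> exec Q (Cond b c1 c2) s (1 + t) s'"
| CondFalse: "\<not> bval b s \<Longrightarrow> exec Q c2 s t s' \<Longrightarrow> exec Q (Cond b c1 c2) s (1 + t) s'"
| WhileFalse: "\<not> bval b s \<Longrightarrow> exec Q (While b c) s 1 s"
| WhileTrue: "bval b s \<Longrightarrow> exec Q c s t1 s1 \<Longrightarrow> exec Q (While b c) s1 t2 s2 \<Longrightarrow>
    exec Q (While b c) s (1 + t1 + t2) s2"

inductive_cases SkipE: "exec Q Skip s t s'"
inductive_cases AssignE: "exec Q (Assign x i j a) s t s'"
inductive_cases RAssignE: "exec Q (RAssign x i a) s t s'"
inductive_cases QueryE: "exec Q (Query q k x) s t s'"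
inductive_cases SeqE: "exec Q (Seq c1 c2) s t s'"
inductive_cases CondE: "exec Q (Cond b c1 c2) s t s'"
inductive_cases WhileE: "exec Q (While b c) s t s'"

lemma exec_deterministic:
  "exec Q c s t s' \<Longrightarrow> exec Q c s u s'' \<Longrightarrow> t = u \<and> s' = s''"
proof (induction arbitrary: u s'' rule: exec.induct)
  case (Skip s)
  then show ?case by (rule SkipE) simp
next
  case (Assign x i j a s)
  then show ?case by (rule AssignE) simp
next
  case (RAssign x i a s)
  then show ?case by (rule RAssignE) simp
next
  case (Query q k x s)
  then show ?case by (rule QueryE) simp
next
  case (Seq c1 s t1 s1 c2 t2 s2)
  from Seq.prems show ?case
  proof (rule SeqE)
    fix u1 r1 u2
    assume u: "u = u1 + u2" and f: "exec Q c1 s u1 r1" and g: "exec Q c2 r1 u2 s''"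
    have "t1 = u1" "s1 = r1" using Seq.IH(1)[OF f] by auto
    then show ?thesis using Seq.IH(2)[of u2 s''] g u by simp
  qed
next
  case (CondTrue b s c1 t s' c2)
  from CondTrue.prems show ?case
  proof (rule CondE)
    fix u1 assume "u = Suc u1" "exec Q c1 s u1 s''"
    then show ?thesis using CondTrue.IH[of u1 s''] by simp
  qed (use CondTrue.hyps in simp)
next
  case (CondFalse b s c2 t s' c1)
  from CondFalse.prems show ?case
  proof (rule CondE)
    fix u1 assume "u = Suc u1" "exec Q c2 s u1 s''"
    then show ?thesis using CondFalse.IH[of u1 s''] by simp
  qed (use CondFalse.hyps in simp)
next
  case (WhileFalse b s c)
  from WhileFalse.prems show ?case by (rule WhileE) (use WhileFalse.hyps in simp_all)
next
  case (WhileTrue b s c t1 s1 t2 s2)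
  from WhileTrue.prems show ?case
  proof (rule WhileE)
    fix u1 r1 u2
    assume u: "u = Suc (u1 + u2)" and f: "exec Q c s u1 r1" and g: "exec Q (While b c) r1 u2 s''"
    have "t1 = u1" "s1 = r1" using WhileTrue.IH(1)[OF f] by auto
    then show ?thesis using WhileTrue.IH(2)[of u2 s''] g u by simp
  qed (use WhileTrue.hyps in simp)
qed


section \<open>Input and answers to queries\<close>

text \<open>Initial memory for the graph with vertices \<^term>\<open>{..<n}\<close> and edges \<^term>\<open>{..<m}\<close>.\<close>

definition input_state :: "nat \<Rightarrow> nat \<Rightarrow> (nat \<Rightarrow> nat \<times> nat) \<Rightarrow> (nat \<Rightarrow> real) \<Rightarrow> state" where
  "input_state n m ends c =
     \<lparr>nats = (\<lambda>x i j.
        if x = ''n'' \<and> i = 0 \<and> j = 0 then n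
        else if x = ''m'' \<and> i = 0 \<and> j = 0 then m
        else if x = ''end1'' \<and> i = 0 \<and> j < m then fst (ends j)
        else if x = ''end2'' \<and> i = 0 \<and> j < m then snd (ends j)
        else 0),
      reals = (\<lambda>x j. if x = ''cost'' \<and> j < m then c j else 0)\<rparr>"

text \<open>Nothing is assumed about the order in which the minimal members are listed, nor about
  the answers to queries outside \<open>E\<close>.\<close>

definition answers_minimal ::
    "'e set \<Rightarrow> ('e \<Rightarrow> 'v \<times> 'v) \<Rightarrow> 'v set set \<Rightarrow> ('e set \<Rightarrow> 'v set list) \<Rightarrow> bool" where
  "answers_minimal E ends F Q \<longleftrightarrow>
     (\<forall>I\<subseteq>E. distinct (Q I) \<and> set (Q I) = minimal_members (residual ends F I))"

end

theory Submission
  imports Defs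
begin

text \<open>
  This is the primal-dual method with reverse deletion. While some member of \<open>F\<close> is uncovered,
  the duals of all minimal members of the residual family are raised until an edge becomes tight;
  that edge is bought, and in the end the bought edges are deleted in reverse order as far as
  possible. The ratio is 10 because, for every set \<open>I\<close> of bought edges, an inclusion-minimal
  cover \<open>J\<close> of \<open>F\<^sup>I\<close> satisfies \<open>\<Sum>\<^sub>C d\<^sub>J(C) \<le> 10 k\<close>, where \<open>C\<close> ranges over the \<open>k\<close> minimal members.

  To see this, choose a laminar family of witness sets \<open>W e \<in> F\<^sup>I\<close> with \<open>\<delta>\<^sub>J(W e) = {e}\<close>, and view it
  as a forest. Call a node a chain node if it has exactly one child and no minimal member \<open>C\<close> has
  this node as its smallest enclosing set; there are at most \<open>2 k\<close> other nodes. By Property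
  \<open>(\<gamma>)\<close>, a minimal member that meets some block \<open>W x - W y\<close> of a path of chain nodes contains
  all blocks above it. Hence only one minimal member can meet a path of chain nodes below its
  top block, and such a path together with the non-chain node under it accounts for at most 5
  incidences between edges of \<open>J\<close> and minimal members.
\<close>

section \<open>Laminar witness families\<close>

definition overlap :: "'v set \<Rightarrow> 'v set \<Rightarrow> bool" where
  "overlap A B \<longleftrightarrow> A \<inter> B \<noteq> {} \<and> \<not> A \<subseteq> B \<and> \<not> B \<subseteq> A"

text \<open>
  If \<open>A\<close> and \<open>B\<close> are witnesses for edges \<open>e\<close> and \<open>f\<close>, \<open>p\<close> says whether \<open>f\<close> lies inside \<open>A\<close>, and \<open>q\<close>
  whether \<open>e\<close> lies inside \<open>B\<close>, then \<open>e\<close> is also the only edge of \<open>J\<close> leaving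
  \<open>corner A B p q\<close>. This set need not be in \<open>F\<close>.
\<close>

definition corner :: "'v set \<Rightarrow> 'v set \<Rightarrow> bool \<Rightarrow> bool \<Rightarrow> 'v set" where
  "corner A B p q =
     (if p then (if q then B - A else A \<union> B) else (if q then A \<inter> B else A - B))"

lemma pliable_cases:
  assumes "pliable F" "A \<in> F" "B \<in> F"
  shows "(A \<inter> B \<in> F \<and> A \<union> B \<in> F) \<or> (A \<inter> B \<in> F \<and> A - B \<in> F) \<or> (A \<inter> B \<in> F \<and> B - A \<in> F)
    \<or> (A \<union> B \<in> F \<and> A - B \<in> F) \<or> (A \<union> B \<in> F \<and> B - A \<in> F) \<or> (A - B \<in> F \<and> B - A \<in> F)"
proof -
  have "length (filter (\<lambda>X. X \<in> F) [A \<inter> B, A \<union> B, A - B, B - A]) \<ge> 2"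
    using assms unfolding pliable_def by blast
  then show ?thesis by (auto split: if_splits)
qed

lemma overlap_sym: "overlap A B \<longleftrightarrow> overlap B A"
  unfolding overlap_def by blast

lemma not_overlap: "\<not> overlap A B \<longleftrightarrow> A \<subseteq> B \<or> B \<subseteq> A \<or> A \<inter> B = {}"
  unfolding overlap_def by blast

section \<open>Uncrossing sets while preserving laminarity\<close>

text \<open>Since \<open>A\<close> and \<open>S\<close> overlap, a set laminar with both is laminar
  with each corner of the two; this is the contrapositive. It shows that passing from
  \<open>S\<close> to a corner gains no new overlap.\<close>

lemma overlap_cornerD:
  assumes "overlap A S" "overlap (corner S A p q) D" "\<not> overlap A D"
  shows "overlap D S"
proof -
  have o: "A \<inter> S \<noteq> {}" "\<not> A \<subseteq> S" "\<not> S \<subseteq> A" using assms(1) unfolding overlap_def by auto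
  have n: "A \<subseteq> D \<or> D \<subseteq> A \<or> A \<inter> D = {}" using assms(3) unfolding overlap_def by blast
  show ?thesis
  proof (cases p; cases q)
    assume "p" "q"
    then have "overlap (A - S) D" using assms(2) unfolding corner_def by simp
    then show ?thesis using o n unfolding overlap_def by blast
  next
    assume "p" "\<not>q"
    then have "overlap (S \<union> A) D" using assms(2) unfolding corner_def by simp
    then show ?thesis using o n unfolding overlap_def by blast
  next
    assume "\<not>p" "q"
    then have "overlap (S \<inter> A) D" using assms(2) unfolding corner_def by simp
    then show ?thesis using o n unfolding overlap_def by blast
  next
    assume "\<not>p" "\<not>q"
    then have "overlap (S - A) D" using assms(2) unfolding corner_def by simp
    then show ?thesis using o n unfolding overlap_def by blast
  qed
qed

lemma not_overlap_corner_self: "\<not> overlap (corner A S p q) S"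
  unfolding corner_def overlap_def by auto

text \<open>The flags tie the shapes of both corners to the position of one common point, which
  excludes the bad combinations: \<open>A \<subseteq> D\<close> forbids \<open>u\<close> in
  \<open>A\<close> but not in \<open>D\<close>, and disjointness forbids \<open>u\<close> in both.
  The points \<open>u\<close> and \<open>v\<close> are to be the ends of the edge whose witness is
  \<open>S\<close>.\<close>

lemma not_overlap_corners:
  assumes "\<not> overlap A D"
    and "u \<in> S" "v \<notin> S" "u \<in> A \<longleftrightarrow> v \<in> A" "u \<in> D \<longleftrightarrow> v \<in> D"
  shows "\<not> overlap (corner A S (u \<in> A) p) (corner D S (u \<in> D) q)"
proof -
  consider "A \<subseteq> D" | "D \<subseteq> A" | "A \<inter> D = {}" using assms(1) unfolding overlap_def by blast
  then show ?thesis
  proof cases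
    case 1 then show ?thesis using assms(2-) unfolding corner_def not_overlap
      by (cases "u \<in> A"; cases "u \<in> D"; cases p; cases q; simp; blast)
  next
    case 2 then show ?thesis using assms(2-) unfolding corner_def not_overlap
      by (cases "u \<in> A"; cases "u \<in> D"; cases p; cases q; simp; blast)
  next
    case 3 then show ?thesis using assms(2-) unfolding corner_def not_overlap
      by (cases "u \<in> A"; cases "u \<in> D"; cases p; cases q; simp; blast)
  qed
qed

lemma not_overlap_corner:
  assumes "overlap A S" "\<not> overlap D S" "\<not> overlap A D"
  shows "\<not> overlap (corner A S p q) D"
proof -
  have o: "A \<inter> S \<noteq> {}" "\<not> A \<subseteq> S" "\<not> S \<subseteq> A" using assms(1) unfolding overlap_def by auto
  have "A \<subseteq> D \<or> D \<subseteq> A \<or> A \<inter> D = {}" using assms(3) unfolding overlap_def by blast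
  moreover have "S \<subseteq> D \<or> D \<subseteq> S \<or> D \<inter> S = {}" using assms(2) unfolding overlap_def by blast
  ultimately show ?thesis using o unfolding corner_def not_overlap
    by (cases p; cases q; simp; blast)
qed

section \<open>Existence of a laminar family of witnesses\<close>

locale minimal_cover =
  fixes F :: "'v set set" and J :: "'e set" and ends :: "'e \<Rightarrow> 'v \<times> 'v"
  assumes plia: "pliable F"
    and finite_J: "finite J"
    and covered: "\<And>S. S \<in> F \<Longrightarrow> cut ends J S \<noteq> {}"
    and witness: "\<And>e. e \<in> J \<Longrightarrow> \<exists>S\<in>F. cut ends J S = {e}"
begin

lemma cut_singletonD: "cut ends J A = {e} \<Longrightarrow> e \<in> J"
  unfolding cut_def by blast

lemma cut_singleton_iff:
  assumes "cut ends J A = {e}" "g \<in> J"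
  shows "(fst (ends g) \<in> A) = (snd (ends g) \<in> A) \<longleftrightarrow> g \<noteq> e"
  using assms unfolding cut_def by blast

text \<open>An edge of \<open>J\<close> other than \<open>e\<close> and \<open>f\<close> leaves
  neither \<open>A\<close> nor \<open>S\<close>, hence no Boolean combination of them. The flags
  select the corner whose boundary \<open>e\<close> crosses and \<open>f\<close> does not.\<close>

lemma cut_corner:
  assumes "cut ends J A = {e}" "cut ends J S = {f}" "e \<noteq> f"
  shows "cut ends J (corner A S (fst (ends f) \<in> A) (fst (ends e) \<in> S)) = {e}"
proof -
  have J: "e \<in> J" "f \<in> J" using assms(1,2) by (simp_all add: cut_singletonD)
  have ce: "snd (ends e) \<in> S \<longleftrightarrow> fst (ends e) \<in> S" "snd (ends e) \<in> A \<longleftrightarrow> fst (ends e) \<notin> A"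
    and cf: "snd (ends f) \<in> A \<longleftrightarrow> fst (ends f) \<in> A" "snd (ends f) \<in> S \<longleftrightarrow> fst (ends f) \<notin> S"
    using J \<open>e \<noteq> f\<close> cut_singleton_iff[OF assms(1) J(1)] cut_singleton_iff[OF assms(1) J(2)]
      cut_singleton_iff[OF assms(2) J(1)] cut_singleton_iff[OF assms(2) J(2)] by (blast+)
  have "g \<in> cut ends J (corner A S (fst (ends f) \<in> A) (fst (ends e) \<in> S)) \<longleftrightarrow> g = e" if g: "g \<in> J" for g
  proof -
    consider "g = e" | "g = f" "g \<noteq> e" | "g \<noteq> e" "g \<noteq> f" by blast
    then show ?thesis
    proof cases
      case 3
      then have "snd (ends g) \<in> A \<longleftrightarrow> fst (ends g) \<in> A" "snd (ends g) \<in> S \<longleftrightarrow> fst (ends g) \<in> S"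
        using cut_singleton_iff[OF assms(1) g] cut_singleton_iff[OF assms(2) g] by auto
      then show ?thesis using 3 unfolding cut_def corner_def by simp
    qed (use J ce cf in \<open>simp add: cut_def corner_def\<close>)+
  qed
  moreover have "cut ends J X \<subseteq> J" for X unfolding cut_def by auto
  ultimately show ?thesis using J by blast
qed

text \<open>Of the three corners that may lie in \<open>F\<close>, one is left by both
  \<open>e\<close> and \<open>f\<close> and so witnesses neither. Two of the three do lie in
  \<open>F\<close>, so a corner witnessing one of the edges is among them.\<close>

lemma corner_mem:
  assumes A: "A \<in> F" "cut ends J A = {e}" and S: "S \<in> F" "cut ends J S = {f}" and "e \<noteq> f"
  shows "corner A S (fst (ends f) \<in> A) (fst (ends e) \<in> S) \<in> F \<or>
         corner S A (fst (ends e) \<in> S) (fst (ends f) \<in> A) \<in> F"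
proof -
  have J: "e \<in> J" "f \<in> J" using A(2) S(2) by (simp_all add: cut_singletonD)
  have ce: "snd (ends e) \<in> S \<longleftrightarrow> fst (ends e) \<in> S" "snd (ends e) \<in> A \<longleftrightarrow> fst (ends e) \<notin> A"
    and cf: "snd (ends f) \<in> A \<longleftrightarrow> fst (ends f) \<in> A" "snd (ends f) \<in> S \<longleftrightarrow> fst (ends f) \<notin> S"
    using J \<open>e \<noteq> f\<close> cut_singleton_iff[OF A(2) J(1)] cut_singleton_iff[OF A(2) J(2)]
      cut_singleton_iff[OF S(2) J(1)] cut_singleton_iff[OF S(2) J(2)] by (blast+)
  \<comment> \<open>\<open>X\<close> is the corner that no edge of \<open>J\<close> leaves, so it is not in \<open>F\<close>; of the three other
    corners at least two are.\<close>
  define X where "X = (if fst (ends f) \<in> A then (if fst (ends e) \<in> S then A \<union> S else S - A)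
     else (if fst (ends e) \<in> S then A - S else A \<inter> S))"
  have "g \<notin> cut ends J X" if g: "g \<in> J" for g
  proof -
    consider "g = e" | "g = f" "g \<noteq> e" | "g \<noteq> e" "g \<noteq> f" by blast
    then show ?thesis
    proof cases
      case 3
      then have "snd (ends g) \<in> A \<longleftrightarrow> fst (ends g) \<in> A" "snd (ends g) \<in> S \<longleftrightarrow> fst (ends g) \<in> S"
        using cut_singleton_iff[OF A(2) g] cut_singleton_iff[OF S(2) g] by auto
      then show ?thesis unfolding cut_def X_def by simp
    qed (use ce cf in \<open>simp add: cut_def X_def\<close>)+
  qed
  then have "cut ends J X = {}" unfolding cut_def by blast
  then have "X \<notin> F" using covered by blast
  then show ?thesis using pliable_cases[OF plia A(1) S(1)]
    unfolding X_def corner_def by (cases "fst (ends f) \<in> A"; cases "fst (ends e) \<in> S"; simp add: Un_commute Int_commute; blast)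
qed

text \<open>Induction step on the set of edges. The witness of \<open>f\<close> is chosen with the
  fewest overlaps, an extremal choice after which only old witnesses have to be changed.\<close>

lemma laminar_insert:
  assumes "J0 \<subseteq> J" "f \<in> J - J0"
    and W: "\<And>e. e \<in> J0 \<Longrightarrow> W e \<in> F \<and> cut ends J (W e) = {e}"
    and lam: "\<And>d e. d \<in> J0 \<Longrightarrow> e \<in> J0 \<Longrightarrow> \<not> overlap (W d) (W e)"
  shows "\<exists>W'. (\<forall>e\<in>insert f J0. W' e \<in> F \<and> cut ends J (W' e) = {e}) \<and>
    (\<forall>d\<in>insert f J0. \<forall>e\<in>insert f J0. \<not> overlap (W' d) (W' e))"
proof -
  define ov where "ov S = {e\<in>J0. overlap (W e) S}" for S
  define wit where "wit S \<longleftrightarrow> S \<in> F \<and> cut ends J S = {f}" for S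
  have fin: "finite (ov S)" for S using assms(1) finite_J finite_subset unfolding ov_def by fastforce
  obtain S0 where "wit S0" using witness assms(2) unfolding wit_def by blast
  then obtain S where S: "wit S" and min: "\<And>S'. wit S' \<Longrightarrow> card (ov S) \<le> card (ov S')"
    using ex_has_least_nat[of wit S0 "\<lambda>S. card (ov S)"] by blast
  \<comment> \<open>Replacing \<open>S\<close> by a corner would lower the number of overlaps, so for every set overlapping
    \<open>S\<close> it is that set which can be replaced. All of them are replaced at once.\<close>
  define W' where "W' e = (if e = f then S else if e \<in> ov S
    then corner (W e) S (fst (ends f) \<in> W e) (fst (ends e) \<in> S) else W e)" for e
  have wit': "W' e \<in> F \<and> cut ends J (W' e) = {e}" if "e \<in> J0" for e
  proof (cases "e \<in> ov S")
    case True
    have ef: "e \<noteq> f" using that assms(2) by auto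
    have We: "W e \<in> F" "cut ends J (W e) = {e}" using W that by auto
    have SF: "S \<in> F" "cut ends J S = {f}" using S unfolding wit_def by auto
    let ?S' = "corner S (W e) (fst (ends e) \<in> S) (fst (ends f) \<in> W e)"
    have "?S' \<notin> F"
    proof
      assume "?S' \<in> F"
      then have "wit ?S'" using cut_corner[OF SF(2) We(2)] ef unfolding wit_def by auto
      \<comment> \<open>The corner no longer overlaps \<open>W e\<close>, and by
        \<open>overlap_cornerD\<close> it acquires no new overlap.\<close>
      moreover have "ov ?S' \<subset> ov S"
      proof
        have "d \<in> ov S \<and> d \<noteq> e" if "d \<in> ov ?S'" for d
        proof -
          have "overlap (W e) S" "d \<in> J0" "overlap ?S' (W d)"
            using True that overlap_sym unfolding ov_def by auto
          then show ?thesis using overlap_cornerD[of "W e" S _ _ "W d"] lam[of e d] \<open>e \<in> J0\<close>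
              not_overlap_corner_self unfolding ov_def by (metis (mono_tags, lifting) mem_Collect_eq)
        qed
        then show "ov ?S' \<subseteq> ov S" "ov ?S' \<noteq> ov S" using True by (blast+)
      qed
      ultimately show False using min psubset_card_mono[OF fin] by (metis leD)
    qed
    then have "corner (W e) S (fst (ends f) \<in> W e) (fst (ends e) \<in> S) \<in> F"
      using corner_mem[OF We SF ef] by blast
    then show ?thesis using cut_corner[OF We(2) SF(2) ef] True ef unfolding W'_def by simp
  next
    case False
    then show ?thesis using W that assms(2) unfolding W'_def by auto
  qed
  have "W' f = S" unfolding W'_def by simp
  have lf: "\<not> overlap (W' e) S" if "e \<in> J0" for e
    using that not_overlap_corner_self assms(2) unfolding W'_def ov_def by auto
  have ll: "\<not> overlap (W' d) (W' e)" if de: "d \<in> J0" "e \<in> J0" for d e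
  proof -
    have L: "\<not> overlap (W d) (W e)" using lam de by auto
    have ne: "d \<noteq> f" "e \<noteq> f" using de assms(2) by auto
    have SF: "cut ends J S = {f}" and fJ: "f \<in> J" using S assms(2) unfolding wit_def by auto
    have f1: "(fst (ends f) \<in> W x) = (snd (ends f) \<in> W x)" if "x \<in> J0" for x
      using cut_singleton_iff[of "W x" x f] W[OF that] that assms(2) by auto
    have f2: "(fst (ends f) \<in> S) \<noteq> (snd (ends f) \<in> S)"
      using cut_singleton_iff[OF SF fJ] by auto
    show ?thesis
    proof (cases "d \<in> ov S"; cases "e \<in> ov S")
      assume "d \<in> ov S" "e \<in> ov S"
      then have o: "overlap (W d) S" "overlap (W e) S" unfolding ov_def by auto
      show ?thesis
      \<comment> \<open>\<open>not_overlap_corners\<close> wants the end of \<open>f\<close> inside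
        \<open>S\<close> first. Either end yields the same flags, as \<open>f\<close> leaves neither
        \<open>W d\<close> nor \<open>W e\<close>.\<close>
      proof (cases "fst (ends f) \<in> S")
        case True
        then show ?thesis
          using not_overlap_corners[OF L, where S = S and u = "fst (ends f)" and v = "snd (ends f)"] f1 f2 de ne
            \<open>d \<in> ov S\<close> \<open>e \<in> ov S\<close> unfolding W'_def by auto
      next
        case False
        then show ?thesis
          using not_overlap_corners[OF L, where S = S and u = "snd (ends f)" and v = "fst (ends f)"] f1 f2 de ne
            \<open>d \<in> ov S\<close> \<open>e \<in> ov S\<close> unfolding W'_def by auto
      qed
    next
      assume "d \<in> ov S" "e \<notin> ov S"
      then show ?thesis using not_overlap_corner[of "W d" S "W e"] L ne de
        unfolding W'_def ov_def by auto
    next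
      assume "d \<notin> ov S" "e \<in> ov S"
      then show ?thesis using not_overlap_corner[of "W e" S "W d"] L ne de overlap_sym
        unfolding W'_def ov_def by (auto simp: overlap_sym)
    next
      assume "d \<notin> ov S" "e \<notin> ov S"
      then show ?thesis using L ne unfolding W'_def by auto
    qed
  qed
  have "\<not> overlap S S" unfolding overlap_def by auto
  then have "\<not> overlap (W' d) (W' e)" if "d \<in> insert f J0" "e \<in> insert f J0" for d e
    using that ll lf lf[THEN overlap_sym[THEN arg_cong[where f = Not], THEN iffD1]] \<open>W' f = S\<close> by auto
  moreover have "W' e \<in> F \<and> cut ends J (W' e) = {e}" if "e \<in> insert f J0" for e
    using that wit' \<open>W' f = S\<close> S unfolding wit_def by auto
  ultimately show ?thesis by blast
qed

lemma laminar_witnesses: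
  obtains W where "\<And>e. e \<in> J \<Longrightarrow> W e \<in> F" "\<And>e. e \<in> J \<Longrightarrow> cut ends J (W e) = {e}"
    "\<And>d e. d \<in> J \<Longrightarrow> e \<in> J \<Longrightarrow> \<not> overlap (W d) (W e)"
proof -
  have "\<exists>W. (\<forall>e\<in>J0. W e \<in> F \<and> cut ends J (W e) = {e}) \<and>
    (\<forall>d\<in>J0. \<forall>e\<in>J0. \<not> overlap (W d) (W e))" if "J0 \<subseteq> J" for J0
  proof -
    have "finite J0" using that finite_J finite_subset by blast
    then show ?thesis using that
    proof (induction J0)
      case (insert f J0)
      then obtain W where "\<forall>e\<in>J0. W e \<in> F \<and> cut ends J (W e) = {e}"
        "\<forall>d\<in>J0. \<forall>e\<in>J0. \<not> overlap (W d) (W e)" by auto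
      then show ?case using laminar_insert[of J0 f W] insert.prems insert.hyps by auto
    qed simp
  qed
  from this[OF subset_refl] obtain W where W: "\<forall>e\<in>J. W e \<in> F \<and> cut ends J (W e) = {e}"
    "\<forall>d\<in>J. \<forall>e\<in>J. \<not> overlap (W d) (W e)" by (elim exE conjE)
  show thesis by (rule that[of W]) (use W in simp_all)
qed

end

section \<open>Degrees of the minimal members\<close>

lemma minimal_member_below:
  assumes "finite F" "S \<in> F"
  shows "\<exists>C\<in>minimal_members F. C \<subseteq> S"
proof -
  obtain C where "C \<in> F" "C \<subseteq> S" "\<forall>b\<in>F. b \<subseteq> C \<longrightarrow> C = b"
    using finite_has_minimal2[OF assms] by blast
  then show ?thesis unfolding minimal_members_def by blast
qed

text \<open>If two distinct minimal members met, then their intersection and both differences would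
  be excluded from \<open>F\<close> by minimality, leaving only the union where pliability demands
  two sets.\<close>

lemma minimal_members_disjoint:
  assumes "pliable F" "A \<in> minimal_members F" "B \<in> minimal_members F" "A \<inter> B \<noteq> {}"
  shows "A = B"
proof (rule ccontr)
  assume "A \<noteq> B"
  have AB: "A \<in> F" "B \<in> F" "\<And>S. S \<in> F \<Longrightarrow> \<not> S \<subset> A" "\<And>S. S \<in> F \<Longrightarrow> \<not> S \<subset> B"
    using assms(2,3) unfolding minimal_members_def by simp_all
  have *: "A \<inter> B \<noteq> A" "A \<inter> B \<noteq> B"
    using AB \<open>A \<noteq> B\<close> by (blast+)
  have "A \<inter> B \<notin> F" "A - B \<notin> F" "B - A \<notin> F"
    using AB(3)[of "A \<inter> B"] AB(3)[of "A - B"] AB(4)[of "B - A"] assms(4) * by (blast+)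
  then show False using pliable_cases[OF assms(1) AB(1,2)] by blast
qed

section \<open>The forest of witness sets\<close>

locale laminar_cover = minimal_cover F J ends
  for F :: "'v set set" and J :: "'e set" and ends :: "'e \<Rightarrow> 'v \<times> 'v" +
  fixes V :: "'v set" and W :: "'e \<Rightarrow> 'v set"
  assumes finite_V: "finite V" and F_sub: "F \<subseteq> Pow V" and F_empty: "{} \<notin> F" and F_V: "V \<notin> F"
    and gamma: "\<And>S1 S2 C. \<lbrakk>S1 \<in> F; S2 \<in> F; C \<in> minimal_members F; S1 \<subset> S2; crossing V C S1;
      crossing V C S2\<rbrakk> \<Longrightarrow> S2 - (S1 \<union> C) = {} \<or> S2 - (S1 \<union> C) \<in> F"
    and W_mem: "\<And>e. e \<in> J \<Longrightarrow> W e \<in> F"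
    and W_cut: "\<And>e. e \<in> J \<Longrightarrow> cut ends J (W e) = {e}"
    and W_laminar: "\<And>d e. d \<in> J \<Longrightarrow> e \<in> J \<Longrightarrow> \<not> overlap (W d) (W e)"
begin

abbreviation CC :: "'v set set" where "CC \<equiv> minimal_members F"

definition children :: "'e \<Rightarrow> 'e set" where
  "children x = {y\<in>J. W y \<subset> W x \<and> (\<forall>z\<in>J. \<not> (W y \<subset> W z \<and> W z \<subset> W x))}"

definition owner :: "'e \<Rightarrow> bool" where
  "owner x \<longleftrightarrow> (\<exists>C\<in>CC. C \<subseteq> W x \<and> (\<forall>y\<in>children x. \<not> C \<subseteq> W y))"

definition chain :: "'e set" where
  "chain = {x\<in>J. card (children x) = 1 \<and> \<not> owner x}"

definition child :: "'e \<Rightarrow> 'e" where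
  "child x = the_elem (children x)"

text \<open>Following \<open>child\<close> splits the forest into paths, each consisting of chain
  nodes, possibly none, and one non-chain node at the bottom. These are the upper ends of the
  paths.\<close>

definition tops :: "'e set" where
  "tops = {z\<in>J. \<forall>x\<in>chain. z \<notin> children x}"

definition inner :: "'e \<Rightarrow> 'v" where
  "inner e = (if fst (ends e) \<in> W e then fst (ends e) else snd (ends e))"

definition outer :: "'e \<Rightarrow> 'v" where
  "outer e = (if fst (ends e) \<in> W e then snd (ends e) else fst (ends e))"

lemma finite_F: "finite F"
  using F_sub finite_V finite_subset by blast

lemma CC_sub: "CC \<subseteq> F"
  unfolding minimal_members_def by blast

lemma finite_CC: "finite CC"
  using CC_sub finite_F finite_subset by blast

lemmas CC_disjoint = minimal_members_disjoint[OF plia]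

lemma CC_nonempty: "C \<in> CC \<Longrightarrow> C \<noteq> {}"
  using CC_sub F_empty by auto

lemma W_nonempty: "e \<in> J \<Longrightarrow> W e \<noteq> {}"
  using W_mem F_empty by metis

lemma W_inj: "d \<in> J \<Longrightarrow> e \<in> J \<Longrightarrow> W d = W e \<Longrightarrow> d = e"
  using W_cut by (metis singleton_inject)

lemma W_nested:
  assumes "d \<in> J" "e \<in> J" "W d \<inter> W e \<noteq> {}" "d \<noteq> e"
  shows "W d \<subset> W e \<or> W e \<subset> W d"
  using W_laminar[OF assms(1,2)] W_inj[OF assms(1,2)] assms(3,4) unfolding overlap_def by blast

lemma cut_ends_iff: "e \<in> J \<Longrightarrow> e \<in> cut ends J X \<longleftrightarrow> (inner e \<in> X \<longleftrightarrow> outer e \<notin> X)"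
  unfolding cut_def inner_def outer_def by auto

lemma inner_in: "e \<in> J \<Longrightarrow> inner e \<in> W e" and outer_notin: "e \<in> J \<Longrightarrow> outer e \<notin> W e"
  using W_cut[of e] unfolding cut_def inner_def outer_def by auto+

lemma ends_same_side: "d \<in> J \<Longrightarrow> e \<in> J \<Longrightarrow> d \<noteq> e \<Longrightarrow> inner d \<in> W e \<longleftrightarrow> outer d \<in> W e"
  using W_cut[of e] cut_ends_iff[of d "W e"] by auto

lemma childrenD:
  assumes "y \<in> children x"
  shows "y \<in> J" "W y \<subset> W x" "\<And>z. z \<in> J \<Longrightarrow> W y \<subset> W z \<Longrightarrow> \<not> W z \<subset> W x"
  using assms unfolding children_def by simp_all

lemma below_child:
  assumes "x \<in> J" "y \<in> J" "W y \<subset> W x"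
  shows "\<exists>z\<in>children x. W y \<subseteq> W z"
proof -
  define A where "A = W ` {z\<in>J. W z \<subset> W x}"
  have A: "finite A" "W y \<in> A" using finite_J assms unfolding A_def by simp_all
  obtain w where w: "w \<in> A" "W y \<subseteq> w" "\<forall>b\<in>A. w \<subseteq> b \<longrightarrow> w = b"
    using finite_has_maximal2[OF A] by (elim bexE conjE)
  then obtain z where z: "z \<in> J" "w = W z" "W z \<subset> W x" unfolding A_def by blast
  then have "z \<in> children x" using w(3) unfolding children_def A_def by blast
  then show ?thesis using w z by blast
qed

lemma parent_unique:
  assumes "x \<in> J" "y \<in> J" "z \<in> children x" "z \<in> children y"
  shows "x = y"
proof (rule ccontr)
  assume "x \<noteq> y"
  have "W x \<inter> W y \<noteq> {}"
    using childrenD(1,2)[OF assms(3)] childrenD(2)[OF assms(4)] W_nonempty[of z] by blast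
  then have "W x \<subset> W y \<or> W y \<subset> W x" using W_nested[OF assms(1,2) _ \<open>x \<noteq> y\<close>] by simp
  then show False
    using childrenD(2,3)[OF assms(3)] childrenD(2,3)[OF assms(4)] assms(1,2) by metis
qed

lemma finite_children: "finite (children x)"
  using finite_J unfolding children_def by simp

text \<open>Both \<open>C \<inter> S\<close> and \<open>C - S\<close> are proper subsets of
  \<open>C\<close>, hence not in \<open>F\<close>. Pliability then gives \<open>C \<union> S\<close>
  and \<open>S - C\<close>, and the two remaining conditions of crossing follow since
  \<open>V\<close> and the empty set are not in \<open>F\<close>.\<close>

lemma crossing_minimal:
  assumes C: "C \<in> CC" and S: "S \<in> F" and "C \<inter> S \<noteq> {}" "\<not> C \<subseteq> S"
  shows "crossing V C S"
proof -
  have "C \<inter> S \<notin> F" "C - S \<notin> F"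
    using C assms(3,4) unfolding minimal_members_def by (auto simp: psubset_eq)
  then have "C \<union> S \<in> F" "S - C \<in> F"
    using pliable_cases[OF plia, of C S] S CC_sub C by blast+
  moreover have "V - (C \<union> S) \<noteq> {}"
    using \<open>C \<union> S \<in> F\<close> F_sub F_V by (metis Diff_eq_empty_iff PowD subsetD subset_antisym)
  moreover have "S - C \<noteq> {}" using \<open>S - C \<in> F\<close> F_empty by metis
  ultimately show ?thesis using assms(3,4) unfolding crossing_def by simp
qed

section \<open>Counting the nodes outside \<open>chain\<close>\<close>

lemma leaf_owner:
  assumes "x \<in> J" "children x = {}"
  shows "owner x"
  using minimal_member_below[OF finite_F W_mem[OF assms(1)]] assms(2) unfolding owner_def by blast

text \<open>Choose for each owner a member that it owns. Two owners of the same member would be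
  nested, and then a child of the larger one would already contain that member.\<close>

lemma card_owners: "card {x\<in>J. owner x} \<le> card CC"
proof -
  have "\<forall>x\<in>{x\<in>J. owner x}. \<exists>C. C \<in> CC \<and> C \<subseteq> W x \<and> (\<forall>y\<in>children x. \<not> C \<subseteq> W y)"
    unfolding owner_def by blast
  from bchoice[OF this] obtain g where "\<forall>x\<in>{x\<in>J. owner x}.
      g x \<in> CC \<and> g x \<subseteq> W x \<and> (\<forall>y\<in>children x. \<not> g x \<subseteq> W y)" by (elim exE)
  then have g: "\<And>x. x \<in> J \<Longrightarrow> owner x \<Longrightarrow>
      g x \<in> CC \<and> g x \<subseteq> W x \<and> (\<forall>y\<in>children x. \<not> g x \<subseteq> W y)" by simp
  have "inj_on g {x\<in>J. owner x}"
  proof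
    fix x y assume x: "x \<in> {x\<in>J. owner x}" and y: "y \<in> {x\<in>J. owner x}" and eq: "g x = g y"
    show "x = y"
    proof (rule ccontr)
      assume "x \<noteq> y"
      have "W x \<inter> W y \<noteq> {}" using g[of x] g[of y] x y eq CC_nonempty[of "g x"] by blast
      then have "W x \<subset> W y \<or> W y \<subset> W x" using W_nested x y \<open>x \<noteq> y\<close> by blast
      then show False
        using below_child[of x y] below_child[of y x] g[of x] g[of y] x y eq
        by (metis (mono_tags, lifting) mem_Collect_eq order_trans)
    qed
  qed
  moreover have "g ` {x\<in>J. owner x} \<subseteq> CC" using g by blast
  ultimately show ?thesis using finite_CC card_inj_on_le by blast
qed

text \<open>Each node satisfies 1 + [at least two children] \<le> number of children +
  [no children], and the numbers of children sum to at most \<open>card J\<close> because parents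
  are unique.\<close>

lemma card_branching: "card {x\<in>J. card (children x) \<ge> 2} \<le> card {x\<in>J. children x = {}}"
proof -
  have "(\<Sum>x\<in>J. card (children x)) = card (\<Union>x\<in>J. children x)"
    by (rule card_UN_disjoint[symmetric])
      (use finite_J finite_children parent_unique in \<open>blast+\<close>)
  also have "\<dots> \<le> card J"
    by (rule card_mono[OF finite_J]) (auto simp: children_def)
  finally have 1: "(\<Sum>x\<in>J. card (children x)) \<le> card J" .
  have "(\<Sum>x\<in>J. 1 + (if card (children x) \<ge> 2 then 1 else 0)) \<le>
      (\<Sum>x\<in>J. card (children x) + (if children x = {} then 1 else 0))"
    by (rule sum_mono) (use finite_children card_0_eq in \<open>fastforce simp: not_le less_2_cases_iff\<close>)
  moreover have "(\<Sum>x\<in>J. if P x then 1 else 0) = card {x\<in>J. P x}" for P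
    using finite_J by (simp add: sum.If_cases Int_def)
  ultimately have "card J + card {x\<in>J. card (children x) \<ge> 2} \<le>
      (\<Sum>x\<in>J. card (children x)) + card {x\<in>J. children x = {}}"
    by (simp add: sum.distrib del: One_nat_def)
  then show ?thesis using 1 by simp
qed

text \<open>A node outside \<open>chain\<close> is an owner or has at least two children. The latter
  are no more numerous than the leaves, which are owners, so both kinds are bounded by the number of
  minimal members.\<close>

lemma card_nonchain: "card (J - chain) \<le> 2 * card CC"
proof -
  have "J - chain \<subseteq> {x\<in>J. owner x} \<union> {x\<in>J. card (children x) \<ge> 2}"
  proof
    fix x assume x: "x \<in> J - chain"
    show "x \<in> {x\<in>J. owner x} \<union> {x\<in>J. card (children x) \<ge> 2}"
    proof (cases "children x = {}")
      case True
      then show ?thesis using leaf_owner x by blast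
    next
      case False
      then have "card (children x) \<noteq> 0" using finite_children by simp
      then show ?thesis using x unfolding chain_def by auto
    qed
  qed
  then have "card (J - chain) \<le> card ({x\<in>J. owner x} \<union> {x\<in>J. card (children x) \<ge> 2})"
    by (rule card_mono[rotated]) (use finite_J in simp)
  also have "\<dots> \<le> card {x\<in>J. owner x} + card {x\<in>J. card (children x) \<ge> 2}"
    by (rule card_Un_le)
  also have "card {x\<in>J. card (children x) \<ge> 2} \<le> card {x\<in>J. owner x}"
    by (rule order_trans[OF card_branching card_mono]) (use finite_J leaf_owner in auto)
  finally show ?thesis using card_owners by linarith
qed

section \<open>Paths of chain nodes and their blocks\<close>

lemma children_chain: "x \<in> chain \<Longrightarrow> children x = {child x}"
  unfolding chain_def child_def by (elim CollectE conjE card_1_singletonE) simp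

lemma chain_sub: "chain \<subseteq> J"
  unfolding chain_def by blast

lemma child_in: assumes "x \<in> chain" shows "child x \<in> J" "W (child x) \<subset> W x"
  using childrenD(1,2)[of "child x" x] children_chain[OF assms] by simp_all

lemma child_inj: "inj_on child chain"
proof
  fix x y assume "x \<in> chain" "y \<in> chain" "child x = child y"
  then show "x = y"
    using parent_unique[of x y "child x"] children_chain[of x] children_chain[of y] chain_sub by auto
qed

lemma tops_eq: "tops = J - child ` chain"
  using children_chain unfolding tops_def by auto

text \<open>\<open>child\<close> is injective on \<open>chain\<close>, so both sides count
  \<open>J\<close> without a subset of size \<open>card chain\<close>.\<close>

lemma card_tops: "card tops = card (J - chain)"
proof -
  have "child ` chain \<subseteq> J" using child_in by blast
  then show ?thesis unfolding tops_eq
    using card_image[OF child_inj] chain_sub finite_J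
    by (simp add: card_Diff_subset finite_subset)
qed

definition block :: "'e \<Rightarrow> 'v set" where
  "block x = W x - W (child x)"

text \<open>The only edge of \<open>J\<close> leaving \<open>W x\<close> is \<open>x\<close>, and
  the only one leaving \<open>W (child x)\<close> is \<open>child x\<close>. So \<open>x\<close>
  does not reach into the child's set, and \<open>child x\<close> stays inside
  \<open>W x\<close>.\<close>

lemma
  assumes "x \<in> chain"
  shows inner_block: "inner x \<in> block x" and outer_block: "outer (child x) \<in> block x"
proof -
  have *: "x \<in> J" "child x \<in> J" "W (child x) \<subset> W x" "x \<noteq> child x"
    using child_in[OF assms] chain_sub assms by auto
  show "inner x \<in> block x" "outer (child x) \<in> block x"
    using ends_same_side[OF *(1,2)] ends_same_side[OF *(2,1)] * inner_in[OF *(1)] inner_in[OF *(2)]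
      outer_notin[OF *(1)] outer_notin[OF *(2)] unfolding block_def by auto
qed

text \<open>A minimal member inside \<open>W x\<close> must lie in the set of the only child, since
  \<open>x\<close> is no owner.\<close>

lemma block_no_member:
  assumes "x \<in> chain" "C \<in> CC" "C \<subseteq> W x"
  shows "C \<inter> block x = {}"
proof -
  have "C \<subseteq> W (child x)"
    using assms(2,3) children_chain[OF assms(1)] assms(1) unfolding chain_def owner_def by auto
  then show ?thesis unfolding block_def by blast
qed

text \<open>This is the only place where Property \<open>(\<gamma>)\<close> enters.\<close>

lemma block_subset:
  assumes x: "x \<in> chain" and C: "C \<in> CC" and "C \<inter> W (child x) \<noteq> {}" "\<not> C \<subseteq> W x"
  shows "block x \<subseteq> C"
proof (rule ccontr)
  assume no: "\<not> block x \<subseteq> C"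
  have *: "W (child x) \<in> F" "W x \<in> F" "W (child x) \<subset> W x"
    using child_in[OF x] W_mem chain_sub x by blast+
  have "crossing V C (W (child x))" "crossing V C (W x)"
    using crossing_minimal[OF C] * assms(3,4) by blast+
  \<comment> \<open>The part of the block outside \<open>C\<close> would be a member of
    \<open>F\<close>, so it would contain a minimal member inside the block, against
    \<open>block_no_member\<close>.\<close>
  then have "W x - (W (child x) \<union> C) \<in> F"
    using gamma[OF *(1,2) C *(3)] no unfolding block_def by blast
  then obtain C' where C': "C' \<in> CC" "C' \<subseteq> W x - (W (child x) \<union> C)"
    using minimal_member_below[OF finite_F] by blast
  then show False using block_no_member[OF x C'(1)] CC_nonempty[OF C'(1)] unfolding block_def by blast
qed

text \<open>A minimal member meeting the block of a chain node is not inside that node's set. It is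
  not inside \<open>W x\<close> either, since \<open>x\<close> is no owner and would pass it down to
  the child. Hence \<open>block_subset\<close> applies.\<close>

lemma block_above_subset:
  assumes x: "x \<in> chain" "child x \<in> chain" and C: "C \<in> CC" "C \<inter> block (child x) \<noteq> {}"
  shows "block x \<subseteq> C"
proof -
  have "\<not> C \<subseteq> W (child x)" using block_no_member[OF x(2) C(1)] C(2) by blast
  moreover have "C \<inter> W (child x) \<noteq> {}" using C(2) unfolding block_def by blast
  moreover have "\<not> C \<subseteq> W x"
    using block_no_member[OF x(1) C(1)] calculation unfolding block_def by blast
  ultimately show ?thesis using block_subset[OF x(1) C(1)] by blast
qed

definition met :: "'e set" where
  "met = {x\<in>chain. \<exists>C\<in>CC. C \<inter> block x \<noteq> {}}"

definition last_met :: "'e set" where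
  "last_met = {x\<in>met. child x \<notin> met}"

lemma finite_chain: "finite chain" "finite met" "finite last_met"
  using finite_subset[OF chain_sub finite_J] unfolding last_met_def met_def by auto

text \<open>By \<open>block_above_subset\<close> the met nodes of a path form a segment starting at
  its top, so each path with a chain node has at most one lowest met node. The count maps each met
  node below a top to its parent.\<close>

lemma card_last_met: "card last_met \<le> card (tops \<inter> chain)"
proof -
  have "met - tops \<subseteq> child ` (met - last_met)"
  proof
    fix z assume z: "z \<in> met - tops"
    then have zc: "z \<in> chain" unfolding met_def by blast
    then obtain x where x: "x \<in> chain" "z = child x"
      using z chain_sub unfolding tops_eq by blast
    obtain C where C: "C \<in> CC" "C \<inter> block z \<noteq> {}" using z unfolding met_def by blast
    then have "block x \<subseteq> C" using block_above_subset x zc by blast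
    then have "x \<in> met" using C x inner_block[OF x(1)] unfolding met_def by blast
    then show "z \<in> child ` (met - last_met)" using x z unfolding last_met_def by blast
  qed
  then have "card (met - tops) \<le> card (met - last_met)"
    using finite_chain by (meson card_image_le card_mono finite_Diff finite_imageI order_trans)
  moreover have "card (met - last_met) = card met - card last_met" "card last_met \<le> card met"
    using finite_chain by (auto simp: last_met_def intro!: card_Diff_subset card_mono)
  moreover have "card met = card (met - tops) + card (met \<inter> tops)"
    using card_Diff_subset_Int[of met tops] finite_chain card_mono[of met "met \<inter> tops"] by simp
  moreover have "card (met \<inter> tops) \<le> card (tops \<inter> chain)"
    using finite_chain by (auto simp: met_def intro!: card_mono)
  ultimately show ?thesis by linarith
qed

section \<open>Incidences between edges and minimal members\<close>

definition in_edges :: "'e set" where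
  "in_edges = {e\<in>J. \<exists>C\<in>CC. inner e \<in> C \<and> outer e \<notin> C}"

definition out_edges :: "'e set" where
  "out_edges = {e\<in>J. \<exists>C\<in>CC. outer e \<in> C \<and> inner e \<notin> C}"

text \<open>For a chain node \<open>z\<close> below a chain node \<open>x\<close>, a member
  containing the inner end of \<open>z\<close> meets the block of \<open>z\<close>. It therefore
  contains the whole block of \<open>x\<close>, and with it the outer end of
  \<open>z\<close>.\<close>

lemma in_edges_sub: "in_edges \<subseteq> (J - chain) \<union> (tops \<inter> chain)"
proof
  fix z assume z: "z \<in> in_edges"
  have "z \<in> tops" if zc: "z \<in> chain"
  proof (rule ccontr)
    assume "z \<notin> tops"
    then obtain x where x: "x \<in> chain" "z = child x"
      using zc chain_sub unfolding tops_eq by blast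
    obtain C where C: "C \<in> CC" "inner z \<in> C" "outer z \<notin> C" using z unfolding in_edges_def by blast
    then have "block x \<subseteq> C" using block_above_subset x zc inner_block[OF zc] by blast
    then show False using outer_block[OF x(1)] x C by blast
  qed
  then show "z \<in> (J - chain) \<union> (tops \<inter> chain)" using z unfolding in_edges_def by blast
qed

text \<open>For \<open>z = child x\<close> with \<open>x\<close> a chain node, \<open>C\<close>
  meets the block of \<open>x\<close>, so \<open>x\<close> is met. If neither \<open>x\<close> nor
  \<open>z\<close> were lowest, a member meeting the block below \<open>z\<close> would contain the
  blocks of \<open>z\<close> and \<open>x\<close>. By disjointness it would be \<open>C\<close>,
  which would then contain the inner end of \<open>z\<close>.\<close>

lemma out_edges_sub:
  "out_edges \<subseteq> tops \<union> child ` (last_met \<union> {x\<in>chain. child x \<in> last_met})"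
proof
  fix z assume z: "z \<in> out_edges"
  show "z \<in> tops \<union> child ` (last_met \<union> {x\<in>chain. child x \<in> last_met})"
  proof (cases "z \<in> tops")
    case False
    then obtain x where x: "x \<in> chain" "z = child x"
      using z unfolding tops_eq out_edges_def by blast
    obtain C where C: "C \<in> CC" "outer z \<in> C" "inner z \<notin> C" using z unfolding out_edges_def by blast
    have xm: "x \<in> met" using C outer_block[OF x(1)] x unfolding met_def by blast
    have "x \<in> last_met \<or> z \<in> last_met"
    proof (rule ccontr)
      assume no: "\<not> ?thesis"
      then have zm: "z \<in> met" "child z \<in> met" using xm x unfolding last_met_def by blast+
      then have zc: "z \<in> chain" "child z \<in> chain" unfolding met_def by blast+
      obtain D where D: "D \<in> CC" "D \<inter> block z \<noteq> {}" using zm unfolding met_def by blast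
      obtain E where E: "E \<in> CC" "E \<inter> block (child z) \<noteq> {}" using zm unfolding met_def by blast
      have "block x \<subseteq> D" using block_above_subset x zc D by blast
      then have "D = C" using CC_disjoint[OF D(1) C(1)] C outer_block[OF x(1)] x by blast
      have "block z \<subseteq> E" using block_above_subset zc E by blast
      then have "E = D" using CC_disjoint[OF E(1) D(1)] D by blast
      then show False using \<open>block z \<subseteq> E\<close> \<open>D = C\<close> inner_block[OF zc(1)] C by blast
    qed
    then show ?thesis using x by blast
  qed simp
qed

lemma card_in_edges: "card in_edges \<le> card (J - chain) + card (tops \<inter> chain)"
  using card_mono[OF _ in_edges_sub] card_Un_le[of "J - chain" "tops \<inter> chain"] finite_J finite_chain
  by fastforce

lemma card_out_edges: "card out_edges \<le> card tops + 2 * card (tops \<inter> chain)"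
proof -
  have fin: "finite tops" "finite last_met" using finite_J finite_chain unfolding tops_def by auto
  have "card {x\<in>chain. child x \<in> last_met} \<le> card last_met"
    by (rule card_inj_on_le[where f = child])
      (use child_inj fin in \<open>auto intro: inj_on_subset\<close>)
  then have "card (last_met \<union> {x\<in>chain. child x \<in> last_met}) \<le> 2 * card last_met"
    using card_Un_le[of last_met "{x\<in>chain. child x \<in> last_met}"] by linarith
  moreover have "finite (last_met \<union> {x\<in>chain. child x \<in> last_met})" using fin finite_chain by simp
  ultimately have "card (child ` (last_met \<union> {x\<in>chain. child x \<in> last_met})) \<le> 2 * card last_met"
    using card_image_le order_trans by blast
  moreover have "card out_edges \<le> card (tops \<union> child ` (last_met \<union> {x\<in>chain. child x \<in> last_met}))"
    using out_edges_sub fin finite_chain by (intro card_mono; simp)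
  moreover have "card (tops \<union> child ` (last_met \<union> {x\<in>chain. child x \<in> last_met})) \<le>
      card tops + card (child ` (last_met \<union> {x\<in>chain. child x \<in> last_met}))"
    by (rule card_Un_le)
  ultimately show ?thesis using card_last_met by linarith
qed

text \<open>As the minimal members are disjoint, an edge contributes at most once through its inner
  end and at most once through its outer end.\<close>

lemma sum_degrees_edges: "(\<Sum>C\<in>CC. cut_deg ends J C) \<le> card in_edges + card out_edges"
proof -
  let ?In = "\<lambda>C. {e\<in>J. inner e \<in> C \<and> outer e \<notin> C}" and ?Out = "\<lambda>C. {e\<in>J. outer e \<in> C \<and> inner e \<notin> C}"
  have "(\<Sum>C\<in>CC. cut_deg ends J C) \<le> (\<Sum>C\<in>CC. card (?In C) + card (?Out C))"
  proof (rule sum_mono)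
    fix C
    have "cut ends J C \<subseteq> ?In C \<union> ?Out C"
      using cut_ends_iff unfolding cut_def by blast
    then have "card (cut ends J C) \<le> card (?In C \<union> ?Out C)" using finite_J by (intro card_mono; simp)
    then show "cut_deg ends J C \<le> card (?In C) + card (?Out C)"
      using card_Un_le[of "?In C" "?Out C"] unfolding cut_deg_def by linarith
  qed
  also have "\<dots> = (\<Sum>C\<in>CC. card (?In C)) + (\<Sum>C\<in>CC. card (?Out C))" by (rule sum.distrib)
  also have "(\<Sum>C\<in>CC. card (?In C)) = card (\<Union>C\<in>CC. ?In C)"
    by (rule card_UN_disjoint[symmetric])
      (use finite_CC finite_J CC_disjoint in \<open>(simp; fail)|blast\<close>)+
  also have "(\<Sum>C\<in>CC. card (?Out C)) = card (\<Union>C\<in>CC. ?Out C)"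
    by (rule card_UN_disjoint[symmetric])
      (use finite_CC finite_J CC_disjoint in \<open>(simp; fail)|blast\<close>)+
  also have "(\<Union>C\<in>CC. ?In C) = in_edges" unfolding in_edges_def by blast
  also have "(\<Union>C\<in>CC. ?Out C) = out_edges" unfolding out_edges_def by blast
  finally show ?thesis .
qed

text \<open>Let N be the number of non-chain nodes, which is also the number of tops. Then
  \<open>in_edges\<close> has at most 2 N elements, \<open>out_edges\<close> at most 3 N, and N is
  at most \<open>2 * card CC\<close>.\<close>

lemma sum_degrees: "(\<Sum>C\<in>CC. cut_deg ends J C) \<le> 10 * card CC"
proof -
  have "card (tops \<inter> chain) \<le> card tops" using finite_J unfolding tops_def by (intro card_mono; auto)
  then show ?thesis
    using sum_degrees_edges card_in_edges card_out_edges card_tops card_nonchain by linarith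
qed

end

section \<open>Invariants of the two phases\<close>

lemma covers_iff: "finite J \<Longrightarrow> covers ends J F \<longleftrightarrow> (\<forall>S\<in>F. cut ends J S \<noteq> {})"
  unfolding covers_def cut_deg_def cut_def by (auto simp: Suc_le_eq card_gt_0_iff)

lemma residual_iff: "finite I \<Longrightarrow> S \<in> residual ends F I \<longleftrightarrow> S \<in> F \<and> cut ends I S = {}"
  unfolding residual_def cut_deg_def cut_def by auto

lemma covers_mono: "finite K \<Longrightarrow> J \<subseteq> K \<Longrightarrow> covers ends J F \<Longrightarrow> covers ends K F"
proof -
  assume K: "finite K" "J \<subseteq> K" and c: "covers ends J F"
  have "cut ends J S \<subseteq> cut ends K S" for S using K(2) unfolding cut_def by auto
  then show ?thesis using c covers_iff[OF K(1)] covers_iff[OF finite_subset[OF K(2,1)]]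
    by (metis subset_empty)
qed

lemma cut_Un: "cut ends (I \<union> J) S = cut ends I S \<union> cut ends J S"
  unfolding cut_def by auto

lemma length_filter_mono: "(\<And>x. x \<in> set xs \<Longrightarrow> P x \<Longrightarrow> Q x) \<Longrightarrow> length (filter P xs) \<le> length (filter Q xs)"
  by (induction xs) auto

lemma pliable_residual:
  assumes "pliable F" "finite I"
  shows "pliable (residual ends F I)"
  unfolding pliable_def
proof (intro ballI)
  fix A B assume A: "A \<in> residual ends F I" and B: "B \<in> residual ends F I"
  have "cut ends I X = {}" if "X \<in> {A \<inter> B, A \<union> B, A - B, B - A}" for X
    using A B that residual_iff[OF assms(2)] unfolding cut_def by auto
  then have "length (filter (\<lambda>X. X \<in> F) [A \<inter> B, A \<union> B, A - B, B - A]) \<le>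
      length (filter (\<lambda>X. X \<in> residual ends F I) [A \<inter> B, A \<union> B, A - B, B - A])"
    by (intro length_filter_mono) (auto simp: residual_iff[OF assms(2)])
  moreover have "A \<in> F" "B \<in> F" using A B residual_iff[OF assms(2)] by auto
  ultimately show "2 \<le> length (filter (\<lambda>X. X \<in> residual ends F I) [A \<inter> B, A \<union> B, A - B, B - A])"
    using assms(1) unfolding pliable_def by (meson order_trans)
qed

text \<open>Dropping an edge \<open>e\<close> of \<open>J\<close> uncovers some \<open>S\<close>, so
  \<open>e\<close> is the only edge of \<open>I \<union> J\<close> leaving \<open>S\<close>. Since
  \<open>e\<close> is not in \<open>I\<close>, this \<open>S\<close> lies in the residual family and
  witnesses \<open>e\<close> there.\<close>

lemma degree_bound:
  assumes inst: "cover_instance V E ends c F" and gp: "gamma_pliable V E ends F"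
    and "I \<subseteq> E" "J \<subseteq> E" and cov: "covers ends (I \<union> J) F"
    and min: "\<And>e. e \<in> J \<Longrightarrow> \<not> covers ends (I \<union> J - {e}) F" and "I \<inter> J = {}"
  shows "(\<Sum>C\<in>minimal_members (residual ends F I). cut_deg ends J C)
    \<le> 10 * card (minimal_members (residual ends F I))"
proof -
  let ?F = "residual ends F I"
  have V: "finite V" "F \<subseteq> Pow V" "{} \<notin> F" "V \<notin> F" "finite E"
    using inst unfolding cover_instance_def is_graph_def by auto
  have fin: "finite I" "finite J" using V(5) assms(3,4) finite_subset by blast+
  have sub: "?F \<subseteq> F" unfolding residual_def by auto
  interpret minimal_cover ?F J ends
  proof
    show "pliable ?F" using gp pliable_residual fin unfolding gamma_pliable_def by blast
    show "finite J" by (rule fin)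
    fix S assume "S \<in> ?F"
    then show "cut ends J S \<noteq> {}"
      using cov fin by (auto simp: residual_iff covers_iff cut_Un)
  next
    fix e assume e: "e \<in> J"
    then obtain S where S: "S \<in> F" "cut ends (I \<union> J - {e}) S = {}"
      using min[OF e] fin by (auto simp: covers_iff)
    have "cut ends (I \<union> J) S \<noteq> {}" using cov fin S by (auto simp: covers_iff)
    then have "cut ends J S = {e}" "cut ends I S = {}"
      using S(2) e assms(7) unfolding cut_def by (blast+)
    then show "\<exists>S\<in>?F. cut ends J S = {e}" using S fin by (auto simp: residual_iff)
  qed
  obtain W where W: "\<And>e. e \<in> J \<Longrightarrow> W e \<in> ?F" "\<And>e. e \<in> J \<Longrightarrow> cut ends J (W e) = {e}"
    "\<And>d e. d \<in> J \<Longrightarrow> e \<in> J \<Longrightarrow> \<not> overlap (W d) (W e)"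
    using laminar_witnesses by metis
  interpret laminar_cover ?F J ends V W
  proof
    show "finite V" "?F \<subseteq> Pow V" "{} \<notin> ?F" "V \<notin> ?F" using V sub by auto
    fix S1 S2 C assume "S1 \<in> ?F" "S2 \<in> ?F" "C \<in> minimal_members ?F" "S1 \<subset> S2"
      "crossing V C S1" "crossing V C S2"
    then show "S2 - (S1 \<union> C) = {} \<or> S2 - (S1 \<union> C) \<in> ?F"
      using gp assms(3) unfolding gamma_pliable_def property_gamma_def by blast
  qed (use W in simp_all)
  show ?thesis by (rule sum_degrees)
qed

section \<open>Primal and dual accounting\<close>

text \<open>At every stage, the edges of \<open>J\<close> not yet bought are a minimal addition to
  those already bought; this is the minimality that \<open>degree_bound\<close> asks for.\<close>

definition pruned :: "('e \<Rightarrow> 'v \<times> 'v) \<Rightarrow> 'v set set \<Rightarrow> 'e list \<Rightarrow> 'e set \<Rightarrow> bool" where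
  "pruned ends F es J \<longleftrightarrow> (\<forall>l<length es. \<forall>e\<in>J - set (take l es).
     \<not> covers ends (set (take l es) \<union> J - {e}) F)"

text \<open>
  The machine cannot halve a real number, so all reduced costs \<open>w\<close> are doubled whenever an edge is
  bought. \<open>D\<close> is the value of the dual solution, scaled accordingly.
\<close>

definition dual_inv :: "'e set \<Rightarrow> ('e \<Rightarrow> 'v \<times> 'v) \<Rightarrow> ('e \<Rightarrow> real) \<Rightarrow> 'v set set \<Rightarrow> 'e list
    \<Rightarrow> ('e \<Rightarrow> real) \<Rightarrow> bool" where
  "dual_inv E ends c F es w \<longleftrightarrow> set es \<subseteq> E \<and> distinct es \<and> (\<forall>e\<in>E. 0 \<le> w e) \<and> (\<forall>e\<in>set es. w e = 0) \<and>
     (\<exists>D. (\<forall>X\<subseteq>E. covers ends X F \<longrightarrow> sum w X + D \<le> 2 ^ length es * sum c X) \<and>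
          (\<forall>J\<subseteq>E. covers ends J F \<and> pruned ends F es J \<longrightarrow>
             2 ^ length es * sum c J \<le> sum w J + 10 * D))"

text \<open>The rate at which the reduced cost of \<open>e\<close> falls when the duals of all
  members of \<open>CC\<close> rise together.\<close>

definition active_deg :: "('e \<Rightarrow> 'v \<times> 'v) \<Rightarrow> 'v set set \<Rightarrow> 'e \<Rightarrow> nat" where
  "active_deg ends CC e = card {C\<in>CC. e \<in> cut ends {e} C}"

lemma sum_active_deg:
  assumes "finite CC" "finite X"
  shows "(\<Sum>e\<in>X. active_deg ends CC e) = (\<Sum>C\<in>CC. cut_deg ends X C)"
proof -
  have "(\<Sum>e\<in>X. active_deg ends CC e) = (\<Sum>e\<in>X. \<Sum>C\<in>{C\<in>CC. e \<in> cut ends {e} C}. 1)"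
    unfolding active_deg_def by simp
  also have "\<dots> = (\<Sum>C\<in>CC. \<Sum>e\<in>{e\<in>X. e \<in> cut ends {e} C}. 1)"
    by (rule sum.swap_restrict[OF assms(2,1)])
  also have "\<dots> = (\<Sum>C\<in>CC. cut_deg ends X C)" unfolding cut_deg_def cut_def by simp
  finally show ?thesis .
qed

lemma dual_inv_init:
  assumes "cover_instance V E ends c F"
  shows "dual_inv E ends c F [] c"
  using assms unfolding dual_inv_def cover_instance_def by (auto intro!: exI[of _ 0])

lemma active_deg_zero:
  assumes "finite I" "e \<in> I"
  shows "active_deg ends (minimal_members (residual ends F I)) e = 0"
proof -
  have "e \<notin> cut ends {e} C" if "C \<in> minimal_members (residual ends F I)" for C
  proof -
    have "cut ends I C = {}"
      using that residual_iff[OF assms(1), of C ends F] unfolding minimal_members_def by simp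
    then show ?thesis using assms(2) unfolding cut_def by blast
  qed
  then have "{C \<in> minimal_members (residual ends F I). e \<in> cut ends {e} C} = {}" by blast
  then show ?thesis unfolding active_deg_def by (simp only: card.empty)
qed

lemma finite_minimal_members:
  assumes "cover_instance V E ends c F"
  shows "finite (minimal_members (residual ends F I))"
proof -
  have "minimal_members (residual ends F I) \<subseteq> Pow V" "finite V"
    using assms unfolding cover_instance_def is_graph_def minimal_members_def residual_def by auto
  then show ?thesis using finite_subset by blast
qed

text \<open>Raising all active duals by \<open>eps\<close> in the doubled scale lowers the reduced
  cost of an edge set by \<open>eps\<close> times the sum of its degrees. That sum is at least
  \<open>card CC\<close> for a cover and at most \<open>10 * card CC\<close> for a pruned one, so
  both inequalities survive with the new dual value.\<close>

lemma dual_inv_step: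
  assumes inst: "cover_instance V E ends c F" and gp: "gamma_pliable V E ends F"
    and inv: "dual_inv E ends c F es w"
    and CC: "CC = minimal_members (residual ends F (set es))"
    and b: "b \<in> E" "0 < active_deg ends CC b" "real (active_deg ends CC b) * eps = 2 * w b"
    and le: "\<And>e. e \<in> E \<Longrightarrow> real (active_deg ends CC e) * eps \<le> 2 * w e"
    and w': "\<And>e. e \<in> E \<Longrightarrow> w' e = 2 * w e - real (active_deg ends CC e) * eps"
  shows "dual_inv E ends c F (es @ [b]) w'"
proof -
  let ?a = "active_deg ends CC"
  obtain D where DD: "\<forall>X\<subseteq>E. covers ends X F \<longrightarrow> sum w X + D \<le> 2 ^ length es * sum c X"
    "\<forall>J\<subseteq>E. covers ends J F \<and> pruned ends F es J \<longrightarrow>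
             2 ^ length es * sum c J \<le> sum w J + 10 * D"
    using inv unfolding dual_inv_def by (elim conjE exE)
  note D = DD(1)[rule_format] DD(2)[rule_format, OF _ conjI]
  have es: "set es \<subseteq> E" "distinct es" "\<And>e. e \<in> E \<Longrightarrow> 0 \<le> w e" "\<And>e. e \<in> set es \<Longrightarrow> w e = 0"
    using inv unfolding dual_inv_def by auto
  have finE: "finite E" using inst unfolding cover_instance_def is_graph_def by auto
  have a0: "?a e = 0" if "e \<in> set es" for e using active_deg_zero that unfolding CC by (metis List.finite_set)
  have bes: "b \<notin> set es" using a0 b by auto
  have eps: "eps \<ge> 0"
    using b es(3)[of b] zero_le_mult_iff[of "real (?a b)" eps] by auto
  have finCC: "finite CC" using finite_minimal_members[OF inst] CC by simp
  have CCF: "CC \<subseteq> F" unfolding CC minimal_members_def residual_def by auto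
  \<comment> \<open>The old dual value doubles with the scale, and each raised dual adds
    \<open>eps\<close>.\<close>
  define D2 where "D2 = 2 * D + eps * card CC"
  have sw': "sum w' X = 2 * sum w X - eps * real (\<Sum>C\<in>CC. cut_deg ends X C)" if "X \<subseteq> E" for X
  proof -
    have fX: "finite X" using that finE finite_subset by blast
    have "sum w' X = (\<Sum>e\<in>X. 2 * w e - eps * real (?a e))"
      using that by (intro sum.cong) (auto simp: w' mult.commute)
    also have "\<dots> = 2 * sum w X - eps * real (\<Sum>e\<in>X. ?a e)"
      by (simp add: sum_subtractf sum_distrib_left)
    finally show ?thesis using sum_active_deg[OF finCC fX] by simp
  qed
  have "sum w' X + D2 \<le> 2 ^ length (es @ [b]) * sum c X" if "X \<subseteq> E" "covers ends X F" for X
  proof -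
    have "(\<Sum>C\<in>CC. 1) \<le> (\<Sum>C\<in>CC. cut_deg ends X C)"
      using that CCF unfolding covers_def by (intro sum_mono) auto
    then have "real (card CC) \<le> real (\<Sum>C\<in>CC. cut_deg ends X C)" by (subst of_nat_le_iff) simp
    then have "eps * card CC \<le> eps * real (\<Sum>C\<in>CC. cut_deg ends X C)"
      using eps by (intro mult_left_mono)
    then show ?thesis using D(1)[OF that] sw'[OF that(1)] unfolding D2_def by simp
  qed
  moreover have "2 ^ length (es @ [b]) * sum c J \<le> sum w' J + 10 * D2"
    if J: "J \<subseteq> E" "covers ends J F" and g: "pruned ends F (es @ [b]) J" for J
  proof -
    have g1: "pruned ends F es J" unfolding pruned_def
    proof (intro allI impI)
      fix l assume "l < length es"
      then show "\<forall>e\<in>J - set (take l es). \<not> covers ends (set (take l es) \<union> J - {e}) F"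
        using g[unfolded pruned_def, rule_format, of l] by simp
    qed
    \<comment> \<open>The prefix of length \<open>length es\<close> of the longer list is
      \<open>es\<close>, so \<open>J - set es\<close> is a minimal addition to the edges bought
      before \<open>b\<close>.\<close>
    have g2: "\<not> covers ends (set es \<union> (J - set es) - {e}) F" if "e \<in> J - set es" for e
      using g[unfolded pruned_def, rule_format, of "length es"] that by simp
    have fin: "finite (set es \<union> J)" using J finE finite_subset by auto
    have "(\<Sum>C\<in>CC. cut_deg ends (J - set es) C) \<le> 10 * card CC"
      unfolding CC
    proof (rule degree_bound[OF inst gp])
      show "covers ends (set es \<union> (J - set es)) F"
        using covers_mono[OF fin _ J(2)] by simp
    qed (use es J g2 in auto)
    moreover have "cut_deg ends (J - set es) C = cut_deg ends J C" if "C \<in> CC" for C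
    proof -
      have "cut ends (set es) C = {}"
        using that residual_iff[of "set es" C ends F] unfolding CC minimal_members_def by simp
      then have "cut ends (J - set es) C = cut ends J C" unfolding cut_def by blast
      then show ?thesis unfolding cut_deg_def by simp
    qed
    ultimately have "real (\<Sum>C\<in>CC. cut_deg ends J C) \<le> real (10 * card CC)"
      by (subst of_nat_le_iff) simp
    then have "eps * real (\<Sum>C\<in>CC. cut_deg ends J C) \<le> eps * real (10 * card CC)"
      using eps by (intro mult_left_mono)
    then show ?thesis using D(2)[OF J g1] sw'[OF J(1)] unfolding D2_def by simp
  qed
  moreover have "0 \<le> w' e" if "e \<in> E" for e using le[OF that] w'[OF that] by simp
  moreover have "w' e = 0" if "e \<in> set (es @ [b])" for e
    using that es a0 b w'[of e] by auto
  ultimately show ?thesis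
    unfolding dual_inv_def using es b(1) bes by (auto intro!: exI[of _ D2])
qed

text \<open>Weak duality: reduced costs are non-negative, so \<open>D\<close> is at most the scaled
  optimum. They vanish on the bought edges, so the scaled cost of \<open>J\<close> is at most
  \<open>10 * D\<close>.\<close>

lemma dual_inv_final:
  assumes inst: "cover_instance V E ends c F" and inv: "dual_inv E ends c F es w"
    and J: "J \<subseteq> set es" "covers ends J F" "pruned ends F es J"
  shows "sum c J \<le> 10 * min_cover_cost E ends c F"
proof -
  have "finite E" "covers ends E F" using inst unfolding cover_instance_def is_graph_def by auto
  then have "min_cover_cost E ends c F \<in> sum c ` {J. J \<subseteq> E \<and> covers ends J F}"
    unfolding min_cover_cost_def by (intro Min_in) auto
  then obtain X where X: "X \<subseteq> E" "covers ends X F" "min_cover_cost E ends c F = sum c X" by blast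
  obtain D where D: "sum w X + D \<le> 2 ^ length es * sum c X"
    "2 ^ length es * sum c J \<le> sum w J + 10 * D"
    using inv X J unfolding dual_inv_def by (meson order_trans)
  have "sum w J = 0" "0 \<le> sum w X"
    using inv J X unfolding dual_inv_def by (auto intro!: sum.neutral sum_nonneg)
  then have "2 ^ length es * sum c J \<le> 2 ^ length es * (10 * sum c X)"
    using D by linarith
  then have "sum c J \<le> 10 * sum c X" by (rule mult_left_le_imp_le) simp
  then show ?thesis using X(3) by simp
qed

section \<open>Reverse deletion\<close>

text \<open>The first \<open>i\<close> purchases are still to be examined. A later edge that was
  kept is necessary even when all purchases before it are present, which is the form needed for
  \<open>pruned\<close>.\<close>

definition delete_inv :: "('e \<Rightarrow> 'v \<times> 'v) \<Rightarrow> 'v set set \<Rightarrow> 'e list \<Rightarrow> nat \<Rightarrow> 'e set \<Rightarrow> bool" where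
  "delete_inv ends F es i J \<longleftrightarrow> J \<subseteq> set es \<and> covers ends J F \<and> set (take i es) \<subseteq> J \<and>
     (\<forall>l. i \<le> l \<and> l < length es \<and> es ! l \<in> J \<longrightarrow>
        \<not> covers ends (set (take l es) \<union> J - {es ! l}) F)"

lemma delete_inv_init: "covers ends (set es) F \<Longrightarrow> delete_inv ends F es (length es) (set es)"
  unfolding delete_inv_def by auto

text \<open>A kept edge stays necessary when \<open>J\<close> shrinks, as covering is monotone. At
  position \<open>i\<close> the earlier purchases are all in \<open>J\<close>, so testing
  \<open>J - {es ! i}\<close> alone decides.\<close>

lemma delete_inv_step:
  assumes inv: "delete_inv ends F es (Suc i) J" and "i < length es" "distinct es"
  shows "delete_inv ends F es i (if covers ends (J - {es ! i}) F then J - {es ! i} else J)"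
proof -
  have J: "J \<subseteq> set es" "covers ends J F" "set (take (Suc i) es) \<subseteq> J"
    "\<And>l. Suc i \<le> l \<Longrightarrow> l < length es \<Longrightarrow> es ! l \<in> J \<Longrightarrow>
        \<not> covers ends (set (take l es) \<union> J - {es ! l}) F"
    using inv unfolding delete_inv_def by auto
  have t: "take (Suc i) es = take i es @ [es ! i]" using assms(2) by (rule take_Suc_conv_app_nth)
  have ni: "es ! i \<notin> set (take i es)"
    using assms(2,3) t distinct_take[OF assms(3), of "Suc i"] by simp
  have sub: "set (take i es) \<subseteq> J - {es ! i}" "es ! i \<in> J" using J(3) ni t by auto
  show ?thesis
  proof (cases "covers ends (J - {es ! i}) F")
    case True
    have "\<not> covers ends (set (take l es) \<union> (J - {es ! i}) - {es ! l}) F"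
      if l: "i \<le> l" "l < length es" "es ! l \<in> J - {es ! i}" for l
    proof
      assume c: "covers ends (set (take l es) \<union> (J - {es ! i}) - {es ! l}) F"
      have "finite (set (take l es) \<union> J - {es ! l})" using J(1) finite_subset by auto
      then have "covers ends (set (take l es) \<union> J - {es ! l}) F"
        by (rule covers_mono[OF _ _ c]) blast
      moreover have "Suc i \<le> l" using l by (cases "l = i") auto
      ultimately show False using J(4) l by auto
    qed
    then show ?thesis using True J sub unfolding delete_inv_def by auto
  next
    case False
    have "\<not> covers ends (set (take l es) \<union> J - {es ! l}) F"
      if l: "i \<le> l" "l < length es" "es ! l \<in> J" for l
    proof (cases "l = i")
      case True
      have "set (take l es) \<union> J = J" using sub True by auto
      then show ?thesis using False True by simp
    next
      case False
      then show ?thesis using J(4)[of l] l by simp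
    qed
    then show ?thesis using False J sub unfolding delete_inv_def by auto
  qed
qed

text \<open>An edge of \<open>J\<close> outside the first \<open>l\<close> purchases has a position
  \<open>p \<ge> l\<close>. It is necessary beside the longer prefix \<open>take p es\<close>, hence
  also beside \<open>take l es\<close>.\<close>

lemma delete_inv_final:
  assumes "delete_inv ends F es 0 J"
  shows "pruned ends F es J"
  unfolding pruned_def
proof (intro allI impI ballI notI)
  fix l e assume l: "l < length es" and e: "e \<in> J - set (take l es)"
    and c: "covers ends (set (take l es) \<union> J - {e}) F"
  have J: "J \<subseteq> set es" using assms unfolding delete_inv_def by simp
  then obtain p where p: "p < length es" "e = es ! p" using e by (metis DiffD1 in_set_conv_nth subsetD)
  have "l \<le> p"
  proof (rule ccontr)
    assume "\<not> l \<le> p"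
    then have "take l es ! p = es ! p" "p < length (take l es)" using l by simp_all
    then have "es ! p \<in> set (take l es)" by (metis nth_mem)
    then show False using e p by simp
  qed
  then have "set (take l es) \<subseteq> set (take p es)" by (rule set_take_subset_set_take)
  moreover have "finite (set (take p es) \<union> J - {e})" using J finite_subset by auto
  ultimately have "covers ends (set (take p es) \<union> J - {es ! p}) F"
    using covers_mono[OF _ _ c, of "set (take p es) \<union> J - {e}"] p by blast
  then show False using assms p e unfolding delete_inv_def by auto
qed

text \<open>This lets the program test coverage with a single query, by comparing the length of the
  answer with 0.\<close>

lemma no_minimal_members_iff:
  assumes "cover_instance V E ends c F" "I \<subseteq> E"
  shows "minimal_members (residual ends F I) = {} \<longleftrightarrow> covers ends I F"
proof -
  have fin: "finite F" "finite I"
    using assms finite_subset[of I E] finite_subset[of F "Pow V"] unfolding cover_instance_def is_graph_def by auto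
  have "residual ends F I = {} \<longleftrightarrow> covers ends I F"
    using residual_iff[OF fin(2), of _ ends F] covers_iff[OF fin(2), of ends F] by blast
  moreover have "finite (residual ends F I)" using fin unfolding residual_def by simp
  then have "minimal_members (residual ends F I) = {} \<longleftrightarrow> residual ends F I = {}"
    using minimal_member_below[of "residual ends F I"] unfolding minimal_members_def by blast
  ultimately show ?thesis by simp
qed

section \<open>Total correctness with time bounds\<close>

text \<open>One halting run suffices for total correctness, because by
  \<open>exec_deterministic\<close> it is the only one.\<close>

definition run :: "(nat set \<Rightarrow> nat set list) \<Rightarrow> com \<Rightarrow> state \<Rightarrow> nat \<Rightarrow> (state \<Rightarrow> bool) \<Rightarrow> bool" where
  "run Q c s T P \<longleftrightarrow> (\<exists>t s'. exec Q c s t s' \<and> t \<le> T \<and> P s')"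

lemma runI: "exec Q c s t s' \<Longrightarrow> t \<le> T \<Longrightarrow> P s' \<Longrightarrow> run Q c s T P"
  unfolding run_def by blast

lemma runE:
  assumes "run Q c s T P"
  obtains t s' where "exec Q c s t s'" "t \<le> T" "P s'"
  using assms unfolding run_def by blast

lemma run_mono: "run Q c s T P \<Longrightarrow> T \<le> T' \<Longrightarrow> (\<And>s'. P s' \<Longrightarrow> P' s') \<Longrightarrow> run Q c s T' P'"
  by (elim runE, rule runI, assumption) simp_all

text \<open>This rule and the following simp rules are equivalences, so that the simplifier executes
  straight-line code symbolically and charges each step to \<open>T\<close>.\<close>

lemma run_Skip [simp]: "run Q Skip s T P \<longleftrightarrow> 1 \<le> T \<and> P s"
  by (auto elim!: runE SkipE intro: runI[OF exec.Skip])

lemma run_Assign [simp]: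
  "run Q (Assign x i j a) s T P \<longleftrightarrow> 1 \<le> T \<and> P (set_nat x (nval i s) (nval j s) (nval a s) s)"
  by (auto elim!: runE AssignE intro: runI[OF exec.Assign])

lemma run_RAssign [simp]:
  "run Q (RAssign x i a) s T P \<longleftrightarrow> 1 \<le> T \<and> P (set_real x (nval i s) (rval a s) s)"
  by (auto elim!: runE RAssignE intro: runI[OF exec.RAssign])

lemma run_Query [simp]:
  "run Q (Query q k x) s T P \<longleftrightarrow> 1 \<le> T \<and> P (store_answer k x (Q (read_set s q)) s)"
  by (auto elim!: runE QueryE intro: runI[OF exec.Query])

lemma run_Cond [simp]:
  "run Q (Cond b c1 c2) s T P \<longleftrightarrow> 1 \<le> T \<and> run Q (if bval b s then c1 else c2) s (T - 1) P"
proof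
  assume "run Q (Cond b c1 c2) s T P"
  then obtain t s' where e: "exec Q (Cond b c1 c2) s t s'" and t: "t \<le> T" "P s'"
    by (rule runE)
  from e show "1 \<le> T \<and> run Q (if bval b s then c1 else c2) s (T - 1) P"
  proof (rule CondE)
    fix u assume "bval b s" "t = Suc u" "exec Q c1 s u s'"
    then show ?thesis using t runI[of Q c1 s u s' "T - 1" P] by simp
  next
    fix u assume "\<not> bval b s" "t = Suc u" "exec Q c2 s u s'"
    then show ?thesis using t runI[of Q c2 s u s' "T - 1" P] by simp
  qed
next
  assume a: "1 \<le> T \<and> run Q (if bval b s then c1 else c2) s (T - 1) P"
  then obtain t s' where e: "exec Q (if bval b s then c1 else c2) s t s'" "t \<le> T - 1" "P s'"
    by (elim conjE runE)
  have "1 + t \<le> T" using a e by linarith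
  show "run Q (Cond b c1 c2) s T P"
  proof (cases "bval b s")
    case True
    then show ?thesis using e \<open>1 + t \<le> T\<close> by (intro runI[OF exec.CondTrue]) simp_all
  next
    case False
    then show ?thesis using e \<open>1 + t \<le> T\<close> by (intro runI[OF exec.CondFalse]) simp_all
  qed
qed

lemma run_SeqI:
  assumes "run Q c1 s T1 R" "\<And>s'. R s' \<Longrightarrow> run Q c2 s' T2 P" "T1 + T2 \<le> T"
  shows "run Q (Seq c1 c2) s T P"
proof -
  obtain t1 s1 where 1: "exec Q c1 s t1 s1" "t1 \<le> T1" "R s1" using assms(1) by (rule runE)
  obtain t2 s2 where 2: "exec Q c2 s1 t2 s2" "t2 \<le> T2" "P s2" using assms(2)[OF 1(3)] by (rule runE)
  show ?thesis by (rule runI[OF exec.Seq[OF 1(1) 2(1)]]) (use 1 2 assms(3) in linarith)+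
qed

lemma run_Seq_Assign [simp]:
  "run Q (Seq (Assign x i j a) c) s T P \<longleftrightarrow>
     1 \<le> T \<and> run Q c (set_nat x (nval i s) (nval j s) (nval a s) s) (T - 1) P"
proof
  assume "run Q (Seq (Assign x i j a) c) s T P"
  then obtain t s' where e: "exec Q (Seq (Assign x i j a) c) s t s'" and t: "t \<le> T" "P s'"
    by (rule runE)
  from e obtain t1 s1 t2 where 1: "t = t1 + t2" "exec Q (Assign x i j a) s t1 s1" "exec Q c s1 t2 s'"
    by (rule SeqE)
  from 1(2) have "t1 = 1" "s1 = set_nat x (nval i s) (nval j s) (nval a s) s" by (auto elim: AssignE)
  then show "1 \<le> T \<and> run Q c (set_nat x (nval i s) (nval j s) (nval a s) s) (T - 1) P"
    using 1 t runI[OF 1(3), of "T - 1" P] by simp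
next
  assume "1 \<le> T \<and> run Q c (set_nat x (nval i s) (nval j s) (nval a s) s) (T - 1) P"
  then show "run Q (Seq (Assign x i j a) c) s T P"
    by (intro run_SeqI[where ?T1.0 = 1 and ?T2.0 = "T - 1" and R = "\<lambda>s'. s' = set_nat x (nval i s) (nval j s) (nval a s) s"]) simp_all
qed

lemma run_Seq_RAssign [simp]:
  "run Q (Seq (RAssign x i a) c) s T P \<longleftrightarrow>
     1 \<le> T \<and> run Q c (set_real x (nval i s) (rval a s) s) (T - 1) P"
proof
  assume "run Q (Seq (RAssign x i a) c) s T P"
  then obtain t s' where e: "exec Q (Seq (RAssign x i a) c) s t s'" and t: "t \<le> T" "P s'"
    by (rule runE)
  from e obtain t1 s1 t2 where 1: "t = t1 + t2" "exec Q (RAssign x i a) s t1 s1" "exec Q c s1 t2 s'"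
    by (rule SeqE)
  from 1(2) have "t1 = 1" "s1 = set_real x (nval i s) (rval a s) s" by (auto elim: RAssignE)
  then show "1 \<le> T \<and> run Q c (set_real x (nval i s) (rval a s) s) (T - 1) P"
    using 1 t runI[OF 1(3), of "T - 1" P] by simp
next
  assume "1 \<le> T \<and> run Q c (set_real x (nval i s) (rval a s) s) (T - 1) P"
  then show "run Q (Seq (RAssign x i a) c) s T P"
    by (intro run_SeqI[where ?T1.0 = 1 and ?T2.0 = "T - 1" and R = "\<lambda>s'. s' = set_real x (nval i s) (rval a s) s"]) simp_all
qed

lemma run_Seq_Query [simp]:
  "run Q (Seq (Query q k x) c) s T P \<longleftrightarrow>
     1 \<le> T \<and> run Q c (store_answer k x (Q (read_set s q)) s) (T - 1) P"
proof
  assume "run Q (Seq (Query q k x) c) s T P"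
  then obtain t s' where e: "exec Q (Seq (Query q k x) c) s t s'" and t: "t \<le> T" "P s'"
    by (rule runE)
  from e obtain t1 s1 t2 where 1: "t = t1 + t2" "exec Q (Query q k x) s t1 s1" "exec Q c s1 t2 s'"
    by (rule SeqE)
  from 1(2) have "t1 = 1" "s1 = store_answer k x (Q (read_set s q)) s" by (auto elim: QueryE)
  then show "1 \<le> T \<and> run Q c (store_answer k x (Q (read_set s q)) s) (T - 1) P"
    using 1 t runI[OF 1(3), of "T - 1" P] by simp
next
  assume "1 \<le> T \<and> run Q c (store_answer k x (Q (read_set s q)) s) (T - 1) P"
  then show "run Q (Seq (Query q k x) c) s T P"
    by (intro run_SeqI[where ?T1.0 = 1 and ?T2.0 = "T - 1" and R = "\<lambda>s'. s' = store_answer k x (Q (read_set s q)) s"]) simp_all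
qed

text \<open>The variant \<open>V\<close> bounds the number of rounds. Each pays \<open>T\<close> for
  the body and 1 for its test; the last 1 is the failing test.\<close>

lemma run_While:
  assumes "I s" and step: "\<And>s. I s \<Longrightarrow> bval b s \<Longrightarrow> run Q c s T (\<lambda>s'. I s' \<and> V s' < V s)"
  shows "run Q (While b c) s (V s * (T + 1) + 1) (\<lambda>s'. I s' \<and> \<not> bval b s')"
  using assms(1)
proof (induction "V s" arbitrary: s rule: less_induct)
  case less
  show ?case
  proof (cases "bval b s")
    case True
    then obtain t1 s1 where 1: "exec Q c s t1 s1" "t1 \<le> T" "I s1" "V s1 < V s"
      using step[OF less.prems] unfolding run_def by blast
    then obtain t2 s2 where 2: "exec Q (While b c) s1 t2 s2" "t2 \<le> V s1 * (T + 1) + 1"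
      "I s2" "\<not> bval b s2"
      using less.hyps unfolding run_def by blast
    have "V s1 * (T + 1) + (T + 1) \<le> V s * (T + 1)"
      using mult_le_mono1[of "Suc (V s1)" "V s" "T + 1"] 1(4) by simp
    then have "1 + t1 + t2 \<le> V s * (T + 1) + 1" using 1(2) 2(2) by linarith
    then show ?thesis using exec.WhileTrue[OF True 1(1) 2(1)] 2 unfolding run_def by blast
  next
    case False
    then show ?thesis using exec.WhileFalse[OF False] less.prems unfolding run_def
      by (intro exI[of _ 1] exI[of _ s]) auto
  qed
qed

section \<open>Counting loops\<close>

abbreviation var :: "name \<Rightarrow> nexp" where "var x \<equiv> Elem x (Num 0) (Num 0)"
abbreviation vec :: "name \<Rightarrow> nexp \<Rightarrow> nexp" where "vec x \<equiv> Elem x (Num 0)"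

definition For :: "name \<Rightarrow> nexp \<Rightarrow> com \<Rightarrow> com" where
  "For x N c = Seq (Assign x (Num 0) (Num 0) (Num 0))
     (While (Less (var x) N) (Seq c (Assign x (Num 0) (Num 0) (Add (var x) (Num 1)))))"

lemma nats_set_nat [simp]: "nats (set_nat x i j k s) y =
    (if y = x then (nats s x)(i := (nats s x i)(j := k)) else nats s y)"
  and reals_set_nat [simp]: "reals (set_nat x i j k s) = reals s"
  and nats_set_real [simp]: "nats (set_real x i r s) = nats s"
  and reals_set_real [simp]: "reals (set_real x i r s) y =
    (if y = x then (reals s x)(i := r) else reals s y)"
  unfolding set_nat_def set_real_def by auto

lemma nats_store_answer: "nats (store_answer k x Ss s) y =
    (if y = k then (nats (s\<lparr>nats := (nats s)(x := (\<lambda>i v. if i < length Ss \<and> v \<in> Ss ! i then 1 else 0))\<rparr>) k)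
        (0 := (nats (s\<lparr>nats := (nats s)(x := (\<lambda>i v. if i < length Ss \<and> v \<in> Ss ! i then 1 else 0))\<rparr>) k 0)(0 := length Ss))
     else if y = x then (\<lambda>i v. if i < length Ss \<and> v \<in> Ss ! i then 1 else 0) else nats s y)"
  and reals_store_answer [simp]: "reals (store_answer k x Ss s) = reals s"
  unfolding store_answer_def by auto

text \<open>The expression \<open>N\<close> is evaluated anew before every round, so the invariant
  has to fix its value. A round costs \<open>T\<close> plus a test and an increment; the additive 2
  is the initialisation and the failing test.\<close>

lemma run_For:
  assumes init: "P 0 (set_nat x 0 0 0 s)"
    and bound: "\<And>j s. P j s \<Longrightarrow> nval N s = K"
    and body: "\<And>j s. j < K \<Longrightarrow> nats s x 0 0 = j \<Longrightarrow> P j s \<Longrightarrow>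
      run Q c s T (\<lambda>s'. nats s' x 0 0 = j \<and> P (Suc j) (set_nat x 0 0 (Suc j) s'))"
    and "K * (T + 2) + 2 \<le> T'"
  shows "run Q (For x N c) s T' (P K)"
proof -
  define I where "I s \<longleftrightarrow> nats s x 0 0 \<le> K \<and> P (nats s x 0 0) s" for s
  let ?s = "set_nat x 0 0 0 s"
  have "run Q (While (Less (var x) N) (Seq c (Assign x (Num 0) (Num 0) (Add (var x) (Num 1))))) ?s
     ((K - nats ?s x 0 0) * (T + 1 + 1) + 1) (\<lambda>s'. I s' \<and> \<not> bval (Less (var x) N) s')"
  proof (rule run_While[where V = "\<lambda>s. K - nats s x 0 0"])
    show "I ?s" using init unfolding I_def by simp
    fix s assume I: "I s" and b: "bval (Less (var x) N) s"
    define j where "j = nats s x 0 0"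
    have j: "j < K" "P j s" "nats s x 0 0 = j" using I b bound[of j s] unfolding I_def j_def by auto
    show "run Q (Seq c (Assign x (Num 0) (Num 0) (Add (var x) (Num 1)))) s (T + 1)
        (\<lambda>s'. I s' \<and> K - nats s' x 0 0 < K - nats s x 0 0)"
      by (rule run_SeqI[OF body[OF j(1,3,2)]]) (use j in \<open>auto simp: I_def\<close>)
  qed
  then have "run Q (While (Less (var x) N) (Seq c (Assign x (Num 0) (Num 0) (Add (var x) (Num 1))))) ?s
     (T' - 1) (P K)"
  proof (rule run_mono)
    show "(K - nats ?s x 0 0) * (T + 1 + 1) + 1 \<le> T' - 1" using assms(4) by simp
    fix s' assume a: "I s' \<and> \<not> bval (Less (var x) N) s'"
    then have "nats s' x 0 0 = K" using bound[of "nats s' x 0 0" s'] unfolding I_def by simp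
    then show "P K s'" using a unfolding I_def by simp
  qed
  then show ?thesis using assms(4) unfolding For_def by simp
qed

section \<open>The program\<close>

lemma read_set_set_nat [simp]:
  "read_set (set_nat x i j k s) y = (if y = x \<and> i = 0 then (if k = 0 then read_set s y - {j}
     else insert j (read_set s y)) else read_set s y)"
  unfolding read_set_def by auto

lemma read_set_cong: "nats s' x = nats s x \<Longrightarrow> read_set s' x = read_set s x"
  unfolding read_set_def by simp

lemma sum_nth_eq_card:
  assumes "distinct xs"
  shows "(\<Sum>l<length xs. if P (xs ! l) then 1 else 0) = card {x\<in>set xs. P x}"
proof -
  have "(\<Sum>l<length xs. if P (xs ! l) then 1 else 0) = sum_list (map (\<lambda>x. if P x then 1 else (0::nat)) xs)"
    by (simp add: sum_list_sum_nth atLeast0LessThan)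
  also have "\<dots> = (\<Sum>x\<in>set xs. if P x then 1 else 0)"
    using assms by (simp add: sum.distinct_set_conv_list)
  finally show ?thesis by (simp add: sum.If_cases Int_def)
qed

text \<open>Each end of \<open>e\<close> lies in at most one of the disjoint members. This is what
  allows \<open>2 * w / a\<close> to be formed without division.\<close>

lemma active_deg_le_2:
  assumes "finite CC" and disj: "\<And>A B. A \<in> CC \<Longrightarrow> B \<in> CC \<Longrightarrow> A \<inter> B \<noteq> {} \<Longrightarrow> A = B"
  shows "active_deg ends CC e \<le> 2"
proof -
  have 1: "card {C\<in>CC. v \<in> C} \<le> 1" for v
    using assms by (fastforce simp: card_le_Suc0_iff_eq)
  have "{C\<in>CC. e \<in> cut ends {e} C} \<subseteq> {C\<in>CC. fst (ends e) \<in> C} \<union> {C\<in>CC. snd (ends e) \<in> C}"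
    unfolding cut_def by auto
  then have "active_deg ends CC e \<le> card ({C\<in>CC. fst (ends e) \<in> C} \<union> {C\<in>CC. snd (ends e) \<in> C})"
    unfolding active_deg_def using assms(1) by (intro card_mono; simp)
  also have "\<dots> \<le> card {C\<in>CC. fst (ends e) \<in> C} + card {C\<in>CC. snd (ends e) \<in> C}"
    by (rule card_Un_le)
  finally show ?thesis using 1[of "fst (ends e)"] 1[of "snd (ends e)"] by linarith
qed

section \<open>The program text\<close>

text \<open>The entries of \<open>C\<close> are 0 or 1 and subtraction is truncated, so the two
  differences add up to 1 exactly when the ends lie on different sides of the member.\<close>

definition degree_com :: com where
  "degree_com = Seq (Assign ''a'' (Num 0) (var ''e'') (Num 0))
     (For ''i'' (var ''k'') (Assign ''a'' (Num 0) (var ''e'')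
        (Add (vec ''a'' (var ''e''))
          (Add (Sub (Elem ''C'' (var ''i'') (vec ''end1'' (var ''e'')))
                    (Elem ''C'' (var ''i'') (vec ''end2'' (var ''e''))))
               (Sub (Elem ''C'' (var ''i'') (vec ''end2'' (var ''e'')))
                    (Elem ''C'' (var ''i'') (vec ''end1'' (var ''e''))))))))"

text \<open>
  The degree \<open>a\<close> of an edge is 0, 1 or 2. The second assignment doubles the scalar \<open>r\<close> if \<open>a = 1\<close> and
  writes to the unused entry at index 1 if \<open>a = 2\<close>, so that \<open>r\<close> becomes \<open>2 w / a\<close>.
\<close>

definition select_com :: com where
  "select_com = Cond (Less (Num 0) (vec ''a'' (var ''e'')))
     (Seq (RAssign ''r'' (Num 0) (RElem ''cost'' (var ''e'')))
     (Seq (RAssign ''r'' (Sub (vec ''a'' (var ''e'')) (Num 1))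
        (RAdd (RElem ''r'' (Num 0)) (RElem ''r'' (Num 0))))
     (Cond (BAnd (Less (Num 0) (var ''f'')) (BNot (RLess (RElem ''r'' (Num 0)) (RElem ''eps'' (Num 0)))))
        Skip
        (Seq (Assign ''f'' (Num 0) (Num 0) (Num 1))
        (Seq (Assign ''b'' (Num 0) (Num 0) (var ''e''))
             (RAssign ''eps'' (Num 0) (RElem ''r'' (Num 0))))))))
     Skip"

text \<open>There is no multiplication, so the cost is added to itself and \<open>eps\<close> is
  subtracted \<open>a\<close> times.\<close>

definition update_com :: com where
  "update_com =
     Seq (RAssign ''cost'' (var ''e'')
        (RAdd (RElem ''cost'' (var ''e'')) (RElem ''cost'' (var ''e''))))
     (For ''i'' (vec ''a'' (var ''e'')) (RAssign ''cost'' (var ''e'')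
        (RSub (RElem ''cost'' (var ''e'')) (RElem ''eps'' (Num 0)))))"

text \<open>Here \<open>f\<close> tells whether an edge of positive degree was found,
  \<open>b\<close> is the best one and \<open>eps\<close> its ratio; \<open>o\<close> lists the
  purchases in order, \<open>t\<close> counts them, and \<open>out\<close> is the current edge set.
  The final query prepares the next loop test.\<close>

definition augment_com :: com where
  "augment_com =
     Seq (Assign ''f'' (Num 0) (Num 0) (Num 0))
     (Seq (For ''e'' (var ''m'') (Seq degree_com select_com))
     (Seq (For ''e'' (var ''m'') update_com)
     (Seq (Assign ''out'' (Num 0) (var ''b'') (Num 1))
     (Seq (Assign ''o'' (Num 0) (var ''t'') (var ''b''))
     (Seq (Assign ''t'' (Num 0) (Num 0) (Add (var ''t'') (Num 1)))
          (Query ''out'' ''k'' ''C''))))))"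

definition delete_com :: com where
  "delete_com =
     Seq (Assign ''t'' (Num 0) (Num 0) (Sub (var ''t'') (Num 1)))
     (Seq (Assign ''out'' (Num 0) (vec ''o'' (var ''t'')) (Num 0))
     (Seq (Query ''out'' ''k'' ''C'')
     (Cond (Less (Num 0) (var ''k'')) (Assign ''out'' (Num 0) (vec ''o'' (var ''t'')) (Num 1)) Skip)))"

definition primal_dual_com :: com where
  "primal_dual_com =
     Seq (Query ''out'' ''k'' ''C'')
     (Seq (While (Less (Num 0) (var ''k'')) augment_com)
          (While (Less (Num 0) (var ''t'')) delete_com))"

section \<open>Execution on a fixed instance\<close>

locale instance_run =
  fixes n m :: nat and ends :: "nat \<Rightarrow> nat \<times> nat" and c :: "nat \<Rightarrow> real"
    and F :: "nat set set" and Q :: "nat set \<Rightarrow> nat set list"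
  assumes inst: "cover_instance {..<n} {..<m} ends c F"
    and gp: "gamma_pliable {..<n} {..<m} ends F"
    and ans: "answers_minimal {..<m} ends F Q"
begin

definition graph_in :: "state \<Rightarrow> bool" where
  "graph_in s \<longleftrightarrow> nats s ''m'' 0 0 = m \<and>
     (\<forall>e<m. nats s ''end1'' 0 e = fst (ends e) \<and> nats s ''end2'' 0 e = snd (ends e))"

definition answered :: "state \<Rightarrow> nat set list \<Rightarrow> bool" where
  "answered s Cs \<longleftrightarrow> nats s ''k'' 0 0 = length Cs \<and>
     nats s ''C'' = (\<lambda>i v. if i < length Cs \<and> v \<in> Cs ! i then 1 else 0)"

lemma run_degree_com:
  assumes "nats s ''e'' 0 0 = e" "e < m" "graph_in s" "answered s Cs" "distinct Cs" "length Cs \<le> n"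
  shows "run Q degree_com s (3 * n + 3) (\<lambda>s'. (\<forall>x. x \<notin> {''a'', ''i''} \<longrightarrow> nats s' x = nats s x) \<and>
    reals s' = reals s \<and> nats s' ''a'' 0 = (nats s ''a'' 0)(e := active_deg ends (set Cs) e))"
proof -
  let ?body = "Assign ''a'' (Num 0) (var ''e'')
        (Add (vec ''a'' (var ''e''))
          (Add (Sub (Elem ''C'' (var ''i'') (vec ''end1'' (var ''e'')))
                    (Elem ''C'' (var ''i'') (vec ''end2'' (var ''e''))))
               (Sub (Elem ''C'' (var ''i'') (vec ''end2'' (var ''e'')))
                    (Elem ''C'' (var ''i'') (vec ''end1'' (var ''e''))))))"
  let ?g = "\<lambda>l. if e \<in> cut ends {e} (Cs ! l) then 1 else (0::nat)"
  define I :: "nat \<Rightarrow> state \<Rightarrow> bool" where "I j s' \<longleftrightarrow> (\<forall>x. x \<notin> {''a'', ''i''} \<longrightarrow> nats s' x = nats s x) \<and>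
    reals s' = reals s \<and> nats s' ''a'' 0 = (nats s ''a'' 0)(e := (\<Sum>l<j. ?g l))" for j s'
  have fin: "(\<Sum>l<length Cs. ?g l) = active_deg ends (set Cs) e"
    unfolding active_deg_def by (rule sum_nth_eq_card[OF assms(5)])
  have "run Q (For ''i'' (var ''k'') ?body)
      (set_nat ''a'' 0 e 0 s) (3 * n + 2) (I (length Cs))"
  proof (rule run_For[where T = 1 and K = "length Cs"])
    show "I 0 (set_nat ''i'' 0 0 0 (set_nat ''a'' 0 e 0 s))"
      unfolding I_def by simp
    show "nval (var ''k'') s' = length Cs" if "I j s'" for j s'
      using that assms(4) unfolding I_def answered_def by simp
    show "length Cs * (1 + 2) + 2 \<le> 3 * n + 2" using assms(6) by simp
    fix j s' assume j: "j < length Cs" "nats s' ''i'' 0 0 = j" "I j s'"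
    then show "run Q ?body s' 1 (\<lambda>s'. nats s' ''i'' 0 0 = j \<and> I (Suc j) (set_nat ''i'' 0 0 (Suc j) s'))"
      using assms(1-4) unfolding I_def answered_def graph_in_def
      by (auto simp: cut_def)
  qed
  then have "run Q (For ''i'' (var ''k'') ?body)
      (set_nat ''a'' 0 e 0 s) (3 * n + 2) (\<lambda>s'. (\<forall>x. x \<notin> {''a'', ''i''} \<longrightarrow> nats s' x = nats s x) \<and>
    reals s' = reals s \<and> nats s' ''a'' 0 = (nats s ''a'' 0)(e := active_deg ends (set Cs) e))"
    by (rule run_mono) (simp_all add: I_def fin)
  then show ?thesis using assms(1) unfolding degree_com_def by simp
qed

text \<open>For \<open>d e\<close> equal to 1 or 2 this is \<open>2 * w e / d e\<close>, the rise of
  the duals, in the doubled scale, that makes \<open>e\<close> tight.\<close>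

definition ratio :: "(nat \<Rightarrow> nat) \<Rightarrow> (nat \<Rightarrow> real) \<Rightarrow> nat \<Rightarrow> real" where
  "ratio d w e = (if d e = 1 then w e + w e else w e)"

definition best :: "(nat \<Rightarrow> nat) \<Rightarrow> (nat \<Rightarrow> real) \<Rightarrow> nat \<Rightarrow> state \<Rightarrow> bool" where
  "best d w j s \<longleftrightarrow> (if nats s ''f'' 0 0 = 0 then \<forall>l<j. d l = 0
     else nats s ''b'' 0 0 < j \<and> 0 < d (nats s ''b'' 0 0) \<and>
       reals s ''eps'' 0 = ratio d w (nats s ''b'' 0 0) \<and>
       (\<forall>l<j. 0 < d l \<longrightarrow> reals s ''eps'' 0 \<le> ratio d w l))"

lemma best_cong:
  "nats s' ''f'' = nats s ''f'' \<Longrightarrow> nats s' ''b'' = nats s ''b'' \<Longrightarrow> reals s' ''eps'' = reals s ''eps'' \<Longrightarrow>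
    best d w j s' \<longleftrightarrow> best d w j s"
  unfolding best_def by simp

lemma run_select_com:
  assumes "nats s ''e'' 0 0 = e" "nats s ''a'' 0 e = d e" "reals s ''cost'' = w" "best d w e s"
  shows "run Q select_com s 8 (\<lambda>s'. (\<forall>x. x \<notin> {''f'', ''b''} \<longrightarrow> nats s' x = nats s x) \<and>
    reals s' ''cost'' = w \<and> best d w (Suc e) s')"
proof (cases "d e = 0")
  case True
  then show ?thesis using assms unfolding select_com_def best_def
    by (auto simp: less_Suc_eq)
next
  case False
  then have r: "((reals s ''r'')(0 := w e, d e - Suc 0 := w e + w e)) 0 = ratio d w e"
    unfolding ratio_def by simp
  show ?thesis
  proof (cases "nats s ''f'' 0 0 = 0 \<or> ratio d w e < reals s ''eps'' 0")
    case True
    then have "\<forall>l<e. 0 < d l \<longrightarrow> ratio d w e \<le> ratio d w l"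
      using assms(4) unfolding best_def by (auto split: if_splits intro: less_imp_le less_le_trans)
    then show ?thesis using True False r assms(1-3) unfolding select_com_def best_def
      by (auto simp: less_Suc_eq)
  next
    case no: False
    then show ?thesis using False r assms unfolding select_com_def best_def
      by (auto simp: less_Suc_eq)
  qed
qed

lemma run_scan:
  assumes "graph_in s" "answered s Cs" "distinct Cs" "length Cs \<le> n" "nats s ''f'' 0 0 = 0"
    and d: "d = active_deg ends (set Cs)" and w: "w = reals s ''cost''"
  shows "run Q (For ''e'' (var ''m'') (Seq degree_com select_com)) s (m * (3 * n + 13) + 2)
    (\<lambda>s'. (\<forall>x. x \<notin> {''a'', ''i'', ''e'', ''f'', ''b''} \<longrightarrow> nats s' x = nats s x) \<and>
      reals s' ''cost'' = w \<and> (\<forall>l<m. nats s' ''a'' 0 l = d l) \<and> best d w m s')"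
proof -
  let ?I = "\<lambda>j (s' :: state). (\<forall>x. x \<notin> {''a'', ''i'', ''e'', ''f'', ''b''} \<longrightarrow> nats s' x = nats s x) \<and>
      reals s' ''cost'' = w \<and> (\<forall>l<j. nats s' ''a'' 0 l = d l) \<and> best d w j s'"
  show ?thesis
  proof (rule run_For[where T = "3 * n + 11" and K = m and P = ?I])
    show "?I 0 (set_nat ''e'' 0 0 0 s)" using assms(5) w unfolding best_def by simp
    show "nval (var ''m'') s' = m" if "?I j s'" for j s'
      using that assms(1) unfolding graph_in_def by simp
    show "m * (3 * n + 11 + 2) + 2 \<le> m * (3 * n + 13) + 2" by simp
    fix j s' assume j: "j < m" "nats s' ''e'' 0 0 = j" and I: "?I j s'"
    have g: "graph_in s'" "answered s' Cs"
      using I assms(1,2) unfolding graph_in_def answered_def by simp_all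
    show "run Q (Seq degree_com select_com) s' (3 * n + 11)
       (\<lambda>s'. nats s' ''e'' 0 0 = j \<and> ?I (Suc j) (set_nat ''e'' 0 0 (Suc j) s'))"
    proof (rule run_SeqI[OF run_degree_com[OF j(2,1) g assms(3,4)], where ?T2.0 = 8])
      fix s2 :: state
      assume s2: "(\<forall>x. x \<notin> {''a'', ''i''} \<longrightarrow> nats s2 x = nats s' x) \<and>
        reals s2 = reals s' \<and> nats s2 ''a'' 0 = (nats s' ''a'' 0)(j := active_deg ends (set Cs) j)"
      have b2: "best d w j s2" using s2 I best_cong[of s2 s' d w j] by simp
      have "run Q select_com s2 8 (\<lambda>s3. (\<forall>x. x \<notin> {''f'', ''b''} \<longrightarrow> nats s3 x = nats s2 x) \<and>
        reals s3 ''cost'' = w \<and> best d w (Suc j) s3)"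
      proof (rule run_select_com[OF _ _ _ b2])
        show "nats s2 ''e'' 0 0 = j" using s2[THEN conjunct1] j by simp
        show "nats s2 ''a'' 0 j = d j" using s2[THEN conjunct2] d by simp
        show "reals s2 ''cost'' = w" using s2[THEN conjunct2] I[THEN conjunct2] by simp
      qed
      then show "run Q select_com s2 8
        (\<lambda>s'. nats s' ''e'' 0 0 = j \<and> ?I (Suc j) (set_nat ''e'' 0 0 (Suc j) s'))"
      proof (rule run_mono)
        fix s3 :: state assume s3: "(\<forall>x. x \<notin> {''f'', ''b''} \<longrightarrow> nats s3 x = nats s2 x) \<and>
          reals s3 ''cost'' = w \<and> best d w (Suc j) s3"
        then have "best d w (Suc j) (set_nat ''e'' 0 0 (Suc j) s3)"
          using best_cong[of "set_nat ''e'' 0 0 (Suc j) s3" s3 d w "Suc j"] by simp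
        moreover have fr: "nats s3 x = nats s x" if "x \<notin> {''a'', ''i'', ''e'', ''f'', ''b''}" for x
        proof -
          have "nats s3 x = nats s2 x" using s3[THEN conjunct1] that by simp
          also have "\<dots> = nats s' x" using s2[THEN conjunct1] that by simp
          also have "\<dots> = nats s x" using I[THEN conjunct1] that by simp
          finally show ?thesis .
        qed
        moreover have "nats s3 ''e'' = nats s' ''e''" "nats s3 ''a'' = nats s2 ''a''"
          using s3[THEN conjunct1] s2[THEN conjunct1] by simp_all
        moreover have "\<forall>l<Suc j. nats s2 ''a'' 0 l = d l"
          using s2[THEN conjunct2] I[THEN conjunct2] d by (simp add: less_Suc_eq)
        ultimately show "nats s3 ''e'' 0 0 = j \<and> ?I (Suc j) (set_nat ''e'' 0 0 (Suc j) s3)"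
          using s3 j by simp
      qed simp
    qed simp
  qed
qed

lemma run_update_com:
  assumes "nats s ''e'' 0 0 = e" "nats s ''a'' 0 e \<le> 2"
  shows "run Q update_com s 9 (\<lambda>s'. (\<forall>x. x \<noteq> ''i'' \<longrightarrow> nats s' x = nats s x) \<and>
    reals s' ''eps'' = reals s ''eps'' \<and> reals s' ''cost'' =
      (reals s ''cost'')(e := 2 * reals s ''cost'' e - real (nats s ''a'' 0 e) * reals s ''eps'' 0))"
proof -
  let ?w = "reals s ''cost''"
  have "run Q (For ''i'' (vec ''a'' (var ''e'')) (RAssign ''cost'' (var ''e'')
        (RSub (RElem ''cost'' (var ''e'')) (RElem ''eps'' (Num 0)))))
    (set_real ''cost'' e (?w e + ?w e) s) 8
    (\<lambda>s'. (\<forall>x. x \<noteq> ''i'' \<longrightarrow> nats s' x = nats s x) \<and>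
      reals s' ''eps'' = reals s ''eps'' \<and> reals s' ''cost'' =
      ?w(e := 2 * ?w e - real (nats s ''a'' 0 e) * reals s ''eps'' 0))"
  proof (rule run_mono[OF run_For[where T = 1 and K = "nats s ''a'' 0 e" and P = "\<lambda>j s'.
        (\<forall>x. x \<noteq> ''i'' \<longrightarrow> nats s' x = nats s x) \<and>
        reals s' ''eps'' = reals s ''eps'' \<and> reals s' ''cost'' =
        ?w(e := 2 * ?w e - real j * reals s ''eps'' 0)"]])
  qed (use assms in \<open>auto simp: algebra_simps\<close>)
  then show ?thesis using assms(1) unfolding update_com_def by simp
qed

lemma run_update:
  assumes "graph_in s" and d: "\<And>l. l < m \<Longrightarrow> nats s ''a'' 0 l = d l \<and> d l \<le> 2"
    and w: "w = reals s ''cost''"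
  shows "run Q (For ''e'' (var ''m'') update_com) s (m * 11 + 2)
    (\<lambda>s'. (\<forall>x. x \<notin> {''i'', ''e''} \<longrightarrow> nats s' x = nats s x) \<and>
      (\<forall>l<m. reals s' ''cost'' l = 2 * w l - real (d l) * reals s ''eps'' 0))"
proof -
  let ?I = "\<lambda>j (s' :: state). (\<forall>x. x \<notin> {''i'', ''e''} \<longrightarrow> nats s' x = nats s x) \<and>
      reals s' ''eps'' = reals s ''eps'' \<and>
      (\<forall>l. reals s' ''cost'' l = (if l < j then 2 * w l - real (d l) * reals s ''eps'' 0 else w l))"
  have "run Q (For ''e'' (var ''m'') update_com) s (m * 11 + 2) (?I m)"
  proof (rule run_For[where T = 9 and K = m and P = ?I])
    show "?I 0 (set_nat ''e'' 0 0 0 s)" using w by simp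
    show "nval (var ''m'') s' = m" if "?I j s'" for j s'
      using that assms(1) unfolding graph_in_def by simp
    show "m * (9 + 2) + 2 \<le> m * 11 + 2" by simp
    fix j s' assume j: "j < m" "nats s' ''e'' 0 0 = j" and I: "?I j s'"
    have a: "nats s' ''a'' 0 j = d j" using I d[OF j(1)] by simp
    show "run Q update_com s' 9 (\<lambda>s'. nats s' ''e'' 0 0 = j \<and> ?I (Suc j) (set_nat ''e'' 0 0 (Suc j) s'))"
    proof (rule run_mono[OF run_update_com[OF j(2)]])
      show "nats s' ''a'' 0 j \<le> 2" using a d[OF j(1)] by simp
      fix s2 :: state assume s2: "(\<forall>x. x \<noteq> ''i'' \<longrightarrow> nats s2 x = nats s' x) \<and>
        reals s2 ''eps'' = reals s' ''eps'' \<and> reals s2 ''cost'' =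
        (reals s' ''cost'')(j := 2 * reals s' ''cost'' j - real (nats s' ''a'' 0 j) * reals s' ''eps'' 0)"
      then show "nats s2 ''e'' 0 0 = j \<and> ?I (Suc j) (set_nat ''e'' 0 0 (Suc j) s2)"
        using I j a by (auto simp: less_Suc_eq)
    qed simp
  qed
  then show ?thesis by (rule run_mono) auto
qed


lemma nats_answer: "x \<notin> {''k'', ''C''} \<Longrightarrow> nats (store_answer ''k'' ''C'' Cs s) x = nats s x"
  by (simp add: nats_store_answer)

lemma answered_answer: "answered (store_answer ''k'' ''C'' Cs s) Cs"
  unfolding answered_def by (simp add: nats_store_answer)

lemma graph_in_cong:
  "nats s' ''m'' = nats s ''m'' \<Longrightarrow> nats s' ''end1'' = nats s ''end1'' \<Longrightarrow> nats s' ''end2'' = nats s ''end2'' \<Longrightarrow>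
    graph_in s' \<longleftrightarrow> graph_in s"
  unfolding graph_in_def by simp

text \<open>The minimal members are non-empty and disjoint, so choosing a point from each injects
  them into the \<open>n\<close> vertices. This bounds the loop over an answer.\<close>

lemma answers:
  assumes "I \<subseteq> {..<m}"
  shows "distinct (Q I)" "set (Q I) = minimal_members (residual ends F I)"
    "length (Q I) \<le> n" "active_deg ends (set (Q I)) e \<le> 2" "Q I = [] \<longleftrightarrow> covers ends I F"
proof -
  let ?CC = "minimal_members (residual ends F I)"
  show 1: "distinct (Q I)" "set (Q I) = ?CC"
    using ans assms unfolding answers_minimal_def by auto
  have fI: "finite I" using assms finite_subset by blast
  have "pliable F" using gp unfolding gamma_pliable_def by simp
  then have "pliable (residual ends F I)" using pliable_residual fI by blast
  then have disj: "A = B" if "A \<in> ?CC" "B \<in> ?CC" "A \<inter> B \<noteq> {}" for A B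
    using minimal_members_disjoint that by metis
  have "?CC \<subseteq> F" unfolding minimal_members_def residual_def by auto
  then have CC: "C \<noteq> {}" "C \<subseteq> {..<n}" if "C \<in> ?CC" for C
    using that inst unfolding cover_instance_def by auto
  define g where "g C = (SOME v. v \<in> C)" for C :: "nat set"
  have g: "g C \<in> C" if "C \<in> ?CC" for C
    unfolding g_def using CC(1)[OF that] by (simp add: some_in_eq)
  have "inj_on g ?CC"
  proof
    fix A B assume "A \<in> ?CC" "B \<in> ?CC" "g A = g B"
    then show "A = B" using disj[of A B] g[of A] g[of B] by auto
  qed
  moreover have "g ` ?CC \<subseteq> {..<n}" using g CC(2) by blast
  ultimately have "card ?CC \<le> card {..<n}" by (rule card_inj_on_le) simp
  then show "length (Q I) \<le> n" using 1 distinct_card[of "Q I"] by simp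
  show "active_deg ends (set (Q I)) e \<le> 2"
    by (rule active_deg_le_2[OF List.finite_set]) (use disj 1 in auto)
  show "Q I = [] \<longleftrightarrow> covers ends I F"
    using no_minimal_members_iff[OF inst assms] 1(2) by (metis set_empty)
qed

section \<open>The augmenting phase\<close>

definition grow_inv :: "nat list \<Rightarrow> state \<Rightarrow> bool" where
  "grow_inv es s \<longleftrightarrow> graph_in s \<and> read_set s ''out'' = set es \<and> answered s (Q (set es)) \<and>
     nats s ''t'' 0 0 = length es \<and> (\<forall>i<length es. nats s ''o'' 0 i = es ! i) \<and>
     dual_inv {..<m} ends c F es (reals s ''cost'')"

text \<open>The full edge set covers every member of \<open>F\<close>, so an uncovered minimal
  member is left by some edge. The scan therefore cannot end with \<open>f = 0\<close>.\<close>

lemma exists_active: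
  assumes "I \<subseteq> {..<m}" "Q I \<noteq> []"
  shows "\<exists>e<m. 0 < active_deg ends (set (Q I)) e"
proof -
  obtain C where C: "C \<in> set (Q I)" using assms(2) by (cases "Q I"; auto)
  then have "C \<in> F" using answers(2)[OF assms(1)] unfolding minimal_members_def residual_def by auto
  then have "cut ends {..<m} C \<noteq> {}"
    using inst covers_iff[of "{..<m}" ends F] unfolding cover_instance_def by auto
  then obtain e where e: "e < m" "e \<in> cut ends {e} C" unfolding cut_def by auto
  then have "{C\<in>set (Q I). e \<in> cut ends {e} C} \<noteq> {}" using C by blast
  then have "0 < active_deg ends (set (Q I)) e"
    unfolding active_deg_def by (simp only: card_gt_0_iff) simp
  then show ?thesis using e by blast
qed

lemma run_augment_com:
  assumes inv: "grow_inv es s" and k: "0 < nats s ''k'' 0 0"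
  shows "run Q augment_com s (m * (3 * n + 13) + m * 11 + 9) (\<lambda>s'. \<exists>b. grow_inv (es @ [b]) s')"
proof -
  define w where "w = reals s ''cost''"
  define d where "d = active_deg ends (set (Q (set es)))"
  let ?s = "set_nat ''f'' 0 0 0 s"
  have du: "dual_inv {..<m} ends c F es w" using inv unfolding grow_inv_def w_def by simp
  then have esm: "set es \<subseteq> {..<m}" unfolding dual_inv_def by simp
  note ansI = answers[OF esm]
  have ne: "Q (set es) \<noteq> []" using inv k unfolding grow_inv_def answered_def by auto
  have d2: "d e \<le> 2" for e using ansI(4) unfolding d_def .
  have 1: "run Q (For ''e'' (var ''m'') (Seq degree_com select_com)) ?s (m * (3 * n + 13) + 2)
    (\<lambda>s'. (\<forall>x. x \<notin> {''a'', ''i'', ''e'', ''f'', ''b''} \<longrightarrow> nats s' x = nats ?s x) \<and>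
      reals s' ''cost'' = w \<and> (\<forall>l<m. nats s' ''a'' 0 l = d l) \<and> best d w m s')"
  proof (rule run_scan[OF _ _ ansI(1,3)])
    show "graph_in ?s" "answered ?s (Q (set es))"
      using inv unfolding grow_inv_def graph_in_def answered_def by simp_all
  qed (simp_all add: d_def w_def)
  have 3: "run Q (Seq (Assign ''out'' (Num 0) (var ''b'') (Num 1))
     (Seq (Assign ''o'' (Num 0) (var ''t'') (var ''b''))
     (Seq (Assign ''t'' (Num 0) (Num 0) (Add (var ''t'') (Num 1)))
          (Query ''out'' ''k'' ''C'')))) s2 4 (\<lambda>s'. \<exists>b. grow_inv (es @ [b]) s')"
    if s1: "\<forall>x. x \<notin> {''a'', ''i'', ''e'', ''f'', ''b''} \<longrightarrow> nats s1 x = nats ?s x" "best d w m s1"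
      and s2: "\<forall>x. x \<notin> {''i'', ''e''} \<longrightarrow> nats s2 x = nats s1 x"
        "\<forall>l<m. reals s2 ''cost'' l = 2 * w l - real (d l) * reals s1 ''eps'' 0" for s1 s2
  proof -
    define b where "b = nats s1 ''b'' 0 0"
    define eps where "eps = reals s1 ''eps'' 0"
    \<comment> \<open>With an active edge at hand, \<open>best\<close> is in its second case, so
      \<open>b\<close> and \<open>eps\<close> are meaningful.\<close>
    obtain e0 where "e0 < m" "0 < d e0" using exists_active[OF esm ne] unfolding d_def by blast
    then have b: "b < m" "0 < d b" "eps = ratio d w b" "\<And>l. l < m \<Longrightarrow> 0 < d l \<Longrightarrow> eps \<le> ratio d w l"
      using s1(2) unfolding best_def b_def eps_def by (auto split: if_splits)
    have rat: "real (d l) * ratio d w l = 2 * w l" if "0 < d l" for l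
    proof -
      have "d l = 1 \<or> d l = 2" using that d2[of l] by linarith
      then show ?thesis unfolding ratio_def by auto
    qed
    have du': "dual_inv {..<m} ends c F (es @ [b]) (reals s2 ''cost'')"
    proof (rule dual_inv_step[OF inst gp du ansI(2)])
      fix e assume e: "e \<in> {..<m}"
      show "real (active_deg ends (set (Q (set es))) e) * eps \<le> 2 * w e"
      proof (cases "d e = 0")
        case True
        then show ?thesis using du e unfolding dual_inv_def d_def by simp
      next
        case False
        then have "real (d e) * eps \<le> real (d e) * ratio d w e"
          using b(4)[of e] e by (intro mult_left_mono) auto
        then show ?thesis using rat[of e] False unfolding d_def by simp
      qed
      show "reals s2 ''cost'' e = 2 * w e - real (active_deg ends (set (Q (set es))) e) * eps"
        using s2(2) e unfolding d_def eps_def by simp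
    qed (use b rat[of b] in \<open>auto simp: d_def\<close>)
    have esb: "set (es @ [b]) \<subseteq> {..<m}" using du' unfolding dual_inv_def by simp
    have fr: "nats s2 x = nats s x" if "x \<notin> {''a'', ''i'', ''e'', ''f'', ''b''}" for x
      using s1(1) s2(1) that by auto
    have nb: "nats s2 ''b'' 0 0 = b" using s2(1) unfolding b_def by simp
    have t: "nats s2 ''t'' 0 0 = length es" and o: "\<forall>i<length es. nats s2 ''o'' 0 i = es ! i"
      and g: "graph_in s2" and out: "read_set s2 ''out'' = set es"
      using inv fr[of "''t''"] fr[of "''o''"] fr[of "''out''"] graph_in_cong[of s2 s]
        fr[of "''m''"] fr[of "''end1''"] fr[of "''end2''"] read_set_cong[of s2 "''out''" s]
      unfolding grow_inv_def by auto
    define s3 where "s3 = set_nat ''t'' 0 0 (Suc (length es)) (set_nat ''o'' 0 (length es) b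
        (set_nat ''out'' 0 b 1 s2))"
    have out3: "read_set s3 ''out'' = set (es @ [b])" unfolding s3_def using out by simp
    have "grow_inv (es @ [b]) (store_answer ''k'' ''C'' (Q (set (es @ [b]))) s3)"
    proof -
      let ?t = "store_answer ''k'' ''C'' (Q (set (es @ [b]))) s3"
      have "graph_in ?t" using g graph_in_cong[of ?t s2] by (simp add: nats_answer s3_def)
      moreover have "read_set ?t ''out'' = set (es @ [b])"
        using out3 read_set_cong[of ?t "''out''" s3] by (simp add: nats_answer)
      moreover have "nats ?t ''t'' 0 0 = length (es @ [b])"
        "\<forall>i<length (es @ [b]). nats ?t ''o'' 0 i = (es @ [b]) ! i"
        using o by (simp_all add: nats_answer s3_def nth_append less_Suc_eq)
      moreover have "reals ?t ''cost'' = reals s2 ''cost''" unfolding s3_def by simp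
      ultimately show ?thesis using du' answered_answer unfolding grow_inv_def by simp
    qed
    then show ?thesis using t nb out3 by (auto simp: s3_def)
  qed
  have 2: "run Q (Seq (For ''e'' (var ''m'') update_com) (Seq (Assign ''out'' (Num 0) (var ''b'') (Num 1))
     (Seq (Assign ''o'' (Num 0) (var ''t'') (var ''b''))
     (Seq (Assign ''t'' (Num 0) (Num 0) (Add (var ''t'') (Num 1)))
          (Query ''out'' ''k'' ''C''))))) s1 (m * 11 + 6) (\<lambda>s'. \<exists>b. grow_inv (es @ [b]) s')"
    if s1: "(\<forall>x. x \<notin> {''a'', ''i'', ''e'', ''f'', ''b''} \<longrightarrow> nats s1 x = nats ?s x) \<and>
      reals s1 ''cost'' = w \<and> (\<forall>l<m. nats s1 ''a'' 0 l = d l) \<and> best d w m s1" for s1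
  proof (rule run_SeqI[OF run_update[where d = d and w = w] 3])
    note s1' = s1[THEN conjunct1] s1[THEN conjunct2, THEN conjunct1]
      s1[THEN conjunct2, THEN conjunct2, THEN conjunct1] s1[THEN conjunct2, THEN conjunct2, THEN conjunct2]
    show "graph_in s1" using inv s1'(1) graph_in_cong[of s1 s] unfolding grow_inv_def by simp
    show "nats s1 ''a'' 0 l = d l \<and> d l \<le> 2" if "l < m" for l using s1'(3) d2 that by simp
    show "w = reals s1 ''cost''" using s1'(2) by simp
    fix s2 assume s2: "(\<forall>x. x \<notin> {''i'', ''e''} \<longrightarrow> nats s2 x = nats s1 x) \<and>
      (\<forall>l<m. reals s2 ''cost'' l = 2 * w l - real (d l) * reals s1 ''eps'' 0)"
    show "\<forall>x. x \<notin> {''a'', ''i'', ''e'', ''f'', ''b''} \<longrightarrow> nats s1 x = nats ?s x" by (rule s1'(1))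
    show "best d w m s1" by (rule s1'(4))
    show "\<forall>x. x \<notin> {''i'', ''e''} \<longrightarrow> nats s2 x = nats s1 x"
      "\<forall>l<m. reals s2 ''cost'' l = 2 * w l - real (d l) * reals s1 ''eps'' 0"
      using s2 by (rule conjunct1, rule conjunct2)
  qed simp
  show ?thesis unfolding augment_com_def
    using run_SeqI[OF 1 2, of "8 + (m * (3 * n + 13) + m * 11)"] by simp
qed

section \<open>The deletion phase and the total running time\<close>

definition prune_inv :: "nat list \<Rightarrow> state \<Rightarrow> bool" where
  "prune_inv es s \<longleftrightarrow> nats s ''t'' 0 0 \<le> length es \<and> (\<forall>i<length es. nats s ''o'' 0 i = es ! i) \<and>
     delete_inv ends F es (nats s ''t'' 0 0) (read_set s ''out'')"

lemma run_delete_com: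
  assumes inv: "prune_inv es s" and t: "0 < nats s ''t'' 0 0"
    and es: "set es \<subseteq> {..<m}" "distinct es"
  shows "run Q delete_com s 5 (\<lambda>s'. prune_inv es s' \<and> nats s' ''t'' 0 0 < nats s ''t'' 0 0)"
proof -
  obtain i where i: "nats s ''t'' 0 0 = Suc i" using t by (cases "nats s ''t'' 0 0") auto
  define J where "J = read_set s ''out''"
  have il: "i < length es" and o: "nats s ''o'' 0 i = es ! i"
    and del: "delete_inv ends F es (Suc i) J"
    using inv i unfolding prune_inv_def J_def by auto
  \<comment> \<open>Edge \<open>es ! i\<close> is still in \<open>J\<close>, so putting it back
    after a failed test restores \<open>J\<close>.\<close>
  have J: "J - {es ! i} \<subseteq> {..<m}" "insert (es ! i) (J - {es ! i}) = J"
    using del es il unfolding delete_inv_def by (auto simp: take_Suc_conv_app_nth)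
  note step = delete_inv_step[OF del il es(2)]
  define s1 where "s1 = set_nat ''out'' 0 (es ! i) 0 (set_nat ''t'' 0 0 i s)"
  define s2 where "s2 = store_answer ''k'' ''C'' (Q (J - {es ! i})) s1"
  have s1: "read_set s1 ''out'' = J - {es ! i}" unfolding s1_def J_def by simp
  have s2: "read_set s2 ''out'' = J - {es ! i}" "nats s2 ''t'' 0 0 = i" "nats s2 ''o'' = nats s ''o''"
    "nats s2 ''k'' 0 0 = length (Q (J - {es ! i}))"
    using s1 read_set_cong[of s2 "''out''" s1] answered_answer[of "Q (J - {es ! i})" s1]
    unfolding s2_def by (simp_all add: nats_answer s1_def answered_def)
  have k: "0 < nats s2 ''k'' 0 0 \<longleftrightarrow> \<not> covers ends (J - {es ! i}) F"
    using answers(5)[OF J(1)] s2(4) by simp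
  have oo: "\<forall>i<length es. nats s ''o'' 0 i = es ! i" using inv unfolding prune_inv_def by simp
  have "run Q (Cond (Less (Num 0) (var ''k'')) (Assign ''out'' (Num 0) (vec ''o'' (var ''t'')) (Num 1)) Skip)
     s2 2 (\<lambda>s'. prune_inv es s' \<and> nats s' ''t'' 0 0 < nats s ''t'' 0 0)"
    using k s2 step il i o oo J(2) unfolding prune_inv_def by (simp split: if_splits)
  then show ?thesis
    unfolding delete_com_def using i o s1 by (simp add: s1_def s2_def)
qed

lemma run_primal_dual:
  "run Q primal_dual_com (input_state n m ends c) (m * (m * (3 * n + 13) + m * 11 + 10) + 1 + (m * 6 + 1) + 1)
    (\<lambda>s. read_set s ''out'' \<subseteq> {..<m} \<and> covers ends (read_set s ''out'') F \<and>
       sum c (read_set s ''out'') \<le> 10 * min_cover_cost {..<m} ends c F)"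
proof -
  let ?s = "input_state n m ends c"
  let ?u = "store_answer ''k'' ''C'' (Q {}) ?s"
  have r: "read_set ?s ''out'' = {}" unfolding read_set_def input_state_def by simp
  have du: "dual_inv {..<m} ends c F [] (reals ?s ''cost'')"
  proof -
    have "dual_inv {..<m} ends c F [] c" by (rule dual_inv_init[OF inst])
    \<comment> \<open>The stored costs are 0 from index \<open>m\<close> on, so agreement with
      \<open>c\<close> is claimed only for sets of edges.\<close>
    moreover have "sum (reals ?s ''cost'') X = sum c X" if "X \<subseteq> {..<m}" for X
      using that by (intro sum.cong) (auto simp: input_state_def)
    ultimately show ?thesis unfolding dual_inv_def by (simp add: input_state_def)
  qed
  have "graph_in ?s" unfolding graph_in_def input_state_def by simp
  then have "graph_in ?u" using graph_in_cong[of ?u ?s] by (simp add: nats_answer)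
  moreover have "read_set ?u ''out'' = {}"
    using r read_set_cong[of ?u "''out''" ?s] by (simp add: nats_answer)
  moreover have "nats ?s ''t'' 0 0 = 0" unfolding input_state_def by simp
  then have tu: "nats ?u ''t'' 0 0 = 0" by (simp add: nats_answer)
  ultimately have g0: "grow_inv [] ?u"
    using tu du answered_answer[of "Q {}" ?s] unfolding grow_inv_def by simp
  let ?I = "\<lambda>s. \<exists>es. grow_inv es s"
  \<comment> \<open>No edge is bought twice; this makes \<open>m - t\<close> a variant of the first
    loop.\<close>
  have len: "length es \<le> m" if "grow_inv es s" for es s
  proof -
    have "set es \<subseteq> {..<m}" "distinct es" using that unfolding grow_inv_def dual_inv_def by auto
    then show ?thesis using card_mono[of "{..<m}" "set es"] distinct_card[of es] by simp
  qed
  have "run Q (While (Less (Num 0) (var ''k'')) augment_com) ?u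
      ((m - nats ?u ''t'' 0 0) * (m * (3 * n + 13) + m * 11 + 9 + 1) + 1)
      (\<lambda>s'. ?I s' \<and> \<not> bval (Less (Num 0) (var ''k'')) s')"
  proof (rule run_While[where I = ?I and V = "\<lambda>s. m - nats s ''t'' 0 0"])
    show "?I ?u" using g0 by blast
    fix s assume "?I s" and k: "bval (Less (Num 0) (var ''k'')) s"
    then obtain es where es: "grow_inv es s" by blast
    show "run Q augment_com s (m * (3 * n + 13) + m * 11 + 9)
      (\<lambda>s'. ?I s' \<and> m - nats s' ''t'' 0 0 < m - nats s ''t'' 0 0)"
    proof (rule run_mono[OF run_augment_com[OF es]])
      fix s' assume "\<exists>b. grow_inv (es @ [b]) s'"
      then obtain b where b: "grow_inv (es @ [b]) s'" by blast
      then have "Suc (length es) \<le> m" "nats s' ''t'' 0 0 = Suc (length es)" "nats s ''t'' 0 0 = length es"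
        using len[OF b] es unfolding grow_inv_def by auto
      then show "?I s' \<and> m - nats s' ''t'' 0 0 < m - nats s ''t'' 0 0" using b by auto
    qed (use k in auto)
  qed
  then have 1: "run Q (While (Less (Num 0) (var ''k'')) augment_com) ?u
      (m * (m * (3 * n + 13) + m * 11 + 10) + 1)
      (\<lambda>s'. ?I s' \<and> nats s' ''k'' 0 0 = 0)"
    by (rule run_mono) (use tu in \<open>simp_all add: algebra_simps\<close>)
  have 2: "run Q (While (Less (Num 0) (var ''t'')) delete_com) s (m * 6 + 1)
    (\<lambda>s. read_set s ''out'' \<subseteq> {..<m} \<and> covers ends (read_set s ''out'') F \<and>
       sum c (read_set s ''out'') \<le> 10 * min_cover_cost {..<m} ends c F)"
    if s: "?I s \<and> nats s ''k'' 0 0 = 0" for s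
  proof -
    obtain es where es: "grow_inv es s" using s by blast
    then have sub: "set es \<subseteq> {..<m}" and dis: "distinct es"
      and du: "dual_inv {..<m} ends c F es (reals s ''cost'')" and tl: "nats s ''t'' 0 0 = length es"
      unfolding grow_inv_def dual_inv_def by auto
    have "covers ends (set es) F"
      using answers(5)[OF sub] s es unfolding grow_inv_def answered_def by auto
    then have "prune_inv es s"
      using es delete_inv_init unfolding prune_inv_def grow_inv_def by auto
    then have "run Q (While (Less (Num 0) (var ''t'')) delete_com) s (nats s ''t'' 0 0 * (5 + 1) + 1)
      (\<lambda>s'. prune_inv es s' \<and> \<not> bval (Less (Num 0) (var ''t'')) s')"
      by (rule run_While) (use run_delete_com[OF _ _ sub dis] in auto)
    then show ?thesis
    proof (rule run_mono)
      show "nats s ''t'' 0 0 * (5 + 1) + 1 \<le> m * 6 + 1" using len[OF es] tl by simp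
      fix s' assume "prune_inv es s' \<and> \<not> bval (Less (Num 0) (var ''t'')) s'"
      then have del: "delete_inv ends F es 0 (read_set s' ''out'')" unfolding prune_inv_def by auto
      then have J: "read_set s' ''out'' \<subseteq> set es" "covers ends (read_set s' ''out'') F"
        unfolding delete_inv_def by auto
      then show "read_set s' ''out'' \<subseteq> {..<m} \<and> covers ends (read_set s' ''out'') F \<and>
         sum c (read_set s' ''out'') \<le> 10 * min_cover_cost {..<m} ends c F"
        using dual_inv_final[OF inst du J delete_inv_final[OF del]] sub by auto
    qed
  qed
  show ?thesis unfolding primal_dual_com_def
    using run_SeqI[OF 1 2 order_refl] r by simp
qed

end

theorem theorem2:
  "\<exists>(prog :: com) (p :: nat poly).
     \<forall>(n :: nat) (m :: nat) (ends :: nat \<Rightarrow> nat \<times> nat) (c :: nat \<Rightarrow> real)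
       (F :: nat set set) (Q :: nat set \<Rightarrow> nat set list).
       cover_instance {..<n} {..<m} ends c F \<and>
       gamma_pliable {..<n} {..<m} ends F \<and>
       answers_minimal {..<m} ends F Q \<longrightarrow>
       (\<exists>t s. exec Q prog (input_state n m ends c) t s \<and>
          t \<le> poly p (n + m) \<and>
          (let J = read_set s ''out'' in
             J \<subseteq> {..<m} \<and> covers ends J F \<and>
             sum c J \<le> 10 * min_cover_cost {..<m} ends c F))"
proof (intro exI[of _ primal_dual_com] exI[of _ "[:3, 16, 24, 3:] :: nat poly"] allI impI)
  fix n m :: nat and ends :: "nat \<Rightarrow> nat \<times> nat" and c :: "nat \<Rightarrow> real"
    and F :: "nat set set" and Q :: "nat set \<Rightarrow> nat set list"
  assume "cover_instance {..<n} {..<m} ends c F \<and> gamma_pliable {..<n} {..<m} ends F \<and>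
    answers_minimal {..<m} ends F Q"
  then interpret instance_run n m ends c F Q by unfold_locales auto
  \<comment> \<open>Replacing \<open>n\<close> and \<open>m\<close> by \<open>n + m\<close> turns
    the time bound into a polynomial in one variable, whose expansion has the coefficients 3, 16,
    24, 3.\<close>
  have "m * (m * (3 * n + 13) + m * 11 + 10) + 1 + (m * 6 + 1) + 1 \<le>
      (n + m) * ((n + m) * (3 * (n + m) + 13) + (n + m) * 11 + 10) + 1 + ((n + m) * 6 + 1) + 1"
    by (intro add_mono mult_mono order_refl) simp_all
  also have "\<dots> = poly [:3, 16, 24, 3:] (n + m)" by (simp add: algebra_simps)
  finally show "\<exists>t s. exec Q primal_dual_com (input_state n m ends c) t s \<and>
          t \<le> poly [:3, 16, 24, 3:] (n + m) \<and>
          (let J = read_set s ''out'' in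
             J \<subseteq> {..<m} \<and> covers ends J F \<and>
             sum c J \<le> 10 * min_cover_cost {..<m} ends c F)"
    using run_primal_dual unfolding run_def Let_def by (meson order_trans)
qed

end
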